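(* Let $\mathcal M$ be a one-sorted first-order structure with universe $M$, let $d\ge 1$, let $Q_1,\dots,Q_k$ be parameter-free $\mathcal M$-definable relations on $M^d$ of finite arities, and let $\mathcal P=\langle M^d;Q_1,\dots,Q_k\rangle$. Let $(D,\theta)$ be a uniformly coded, $\mathcal M$-definable symmetry group for $\mathcal P$, with associated group of coded maps $H=H(\mathcal M)$, and assume that $\mathcal P$ is $H$-factorisation faithful over $\mathcal M$. Let $n\ge1$ and let $R\subseteq (M^d)^n$ be any parameter-free $\mathcal M$-definable relation. Then $$R\in \mathrm{Conc}(\mathcal P)\iff R\text{ is preserved by }H.$$
   Context: All definability is parameter-free. $(M^d)^n$ is identified with $M^{dn}$, so a relation on $M^d$ is $\mathcal M$-definable if the corresponding relation on $M$ is. $\mathrm{Conc}(\mathcal P)$ is the set of all relations on $M^d$, of any finite arity $\ge1$, definable in $\mathcal P$ by a parameter-free formula in the language $\{Q_1,\dots,Q_k\}$. $R\subseteq(M^d)^n$ is preserved by a group $H$ of permutations of $M^d$ if $\alpha(R)=R$ for all $\alpha\in H$, where $\alpha$ acts on each entry of a tuple. A uniformly coded, $\mathcal M$-definable symmetry group for $\mathcal P$ consists of a parameter-free formula $D(h)$ in the language of $\mathcal M$, with $h$ an $m$-tuple of variables (the elements of the set $D\subseteq M^m$ it defines are called admissible codes), and a parameter-free formula $\theta(x,y,h)$ with $x,y$ $d$-tuples of variables, such that in $\mathcal M$: (1) for each admissible code $h$, $\theta(\cdot,\cdot,h)$ is the graph of a total bijection $f_h:M^d\to M^d$; (2) every $f_h$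 respects every $Q_i$, i.e. $Q_i(\bar x)\leftrightarrow Q_i(f_h(\bar x))$ for all $\bar x$; (3) some admissible code codes the identity map, for any two admissible codes there is an admissible code coding the composite of their maps, and for every admissible code there is an admissible code coding the inverse map. For any $\mathcal N\equiv\mathcal M$, $H(\mathcal N)=\{f_h:\mathcal N\models D(h)\}$, where $f_h$ is the map with graph $\theta(\cdot,\cdot,h)$ in $\mathcal N$; $H=H(\mathcal M)$. For an ultrafilter $U$ on a set, $\mathcal M^U$ is the ultrapower, with universe $M^U$, and $\mathcal P(\mathcal M^U)=\langle (M^U)^d;Q_1^U,\dots,Q_k^U\rangle$, where $Q_i^U$ is defined in $\mathcal M^U$ by the same formula that defines $Q_i$ in $\mathcal M$. $\mathcal P$ is $H$-factorisation faithful over $\mathcal M$ if for every ultrafilter $U$ (on any set) and every $\alpha\in\mathrm{Aut}(\mathcal P(\mathcal M^U))$ there exist $h\in H(\mathcal M^U)$ and $\sigma\in\mathrm{Aut}(\mathcal M^U)$ with $\alpha=h\circ\widetilde\sigma$, where $\widetilde\sigma:(M^U)^d\to(M^U)^d$ applies $\sigma$ to each coordinate. *)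

theory Defs
  imports Main "HOL-Library.NList"
begin

section \<open>First-order logic with equality\<close>

text \<open>
  A language assigns an arity to each of its symbols; a symbol that is mapped to \<^const>\<open>None\<close>
  does not belong to the language. Constants are function symbols of arity \<open>0\<close>.
\<close>

record ('f, 'r) lang =
  fn_arity :: "'f \<rightharpoonup> nat"
  rel_arity :: "'r \<rightharpoonup> nat"

datatype 'f trm = Var nat | Fn 'f "'f trm list"

datatype ('f, 'r) fm =
    Eq "'f trm" "'f trm"
  | Rel 'r "'f trm list"
  | Neg "('f, 'r) fm"
  | Conj "('f, 'r) fm" "('f, 'r) fm"
  | Exists nat "('f, 'r) fm"

primrec wf_trm :: "('f, 'r) lang \<Rightarrow> 'f trm \<Rightarrow> bool" where
  "wf_trm L (Var i) \<longleftrightarrow> True"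
| "wf_trm L (Fn f ts) \<longleftrightarrow> fn_arity L f = Some (length ts) \<and> list_all (wf_trm L) ts"

primrec wf_fm :: "('f, 'r) lang \<Rightarrow> ('f, 'r) fm \<Rightarrow> bool" where
  "wf_fm L (Eq s t) \<longleftrightarrow> wf_trm L s \<and> wf_trm L t"
| "wf_fm L (Rel r ts) \<longleftrightarrow> rel_arity L r = Some (length ts) \<and> list_all (wf_trm L) ts"
| "wf_fm L (Neg \<phi>) \<longleftrightarrow> wf_fm L \<phi>"
| "wf_fm L (Conj \<phi> \<psi>) \<longleftrightarrow> wf_fm L \<phi> \<and> wf_fm L \<psi>"
| "wf_fm L (Exists i \<phi>) \<longleftrightarrow> wf_fm L \<phi>"

primrec fv_trm :: "'f trm \<Rightarrow> nat set" where
  "fv_trm (Var i) = {i}"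
| "fv_trm (Fn f ts) = \<Union> (set (map fv_trm ts))"

primrec fv_fm :: "('f, 'r) fm \<Rightarrow> nat set" where
  "fv_fm (Eq s t) = fv_trm s \<union> fv_trm t"
| "fv_fm (Rel r ts) = \<Union> (set (map fv_trm ts))"
| "fv_fm (Neg \<phi>) = fv_fm \<phi>"
| "fv_fm (Conj \<phi> \<psi>) = fv_fm \<phi> \<union> fv_fm \<psi>"
| "fv_fm (Exists i \<phi>) = fv_fm \<phi> - {i}"

definition formula_in :: "('f, 'r) lang \<Rightarrow> nat \<Rightarrow> ('f, 'r) fm \<Rightarrow> bool" where
  "formula_in L n \<phi> \<longleftrightarrow> wf_fm L \<phi> \<and> fv_fm \<phi> \<subseteq> {..<n}"

record ('f, 'r, 'a) struct =
  univ :: "'a set"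
  fn_interp :: "'f \<Rightarrow> 'a list \<Rightarrow> 'a"
  rel_interp :: "'r \<Rightarrow> 'a list set"

text \<open>
  The set \<^term>\<open>nlists n A\<close> of the lists of length \<open>n\<close> over \<open>A\<close> plays the role of \<open>A\<^sup>n\<close>.
  The values of an interpretation on symbols outside the language, and on argument lists
  of the wrong length or with entries outside the universe, are irrelevant.
\<close>

definition is_structure :: "('f, 'r) lang \<Rightarrow> ('f, 'r, 'a) struct \<Rightarrow> bool" where
  "is_structure L M \<longleftrightarrow>
     univ M \<noteq> {} \<and>
     (\<forall>f n. fn_arity L f = Some n \<longrightarrow> (\<forall>xs \<in> nlists n (univ M). fn_interp M f xs \<in> univ M)) \<and>
     (\<forall>r n. rel_arity L r = Some n \<longrightarrow> rel_interp M r \<subseteq> nlists n (univ M))"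

primrec eval_trm :: "('f, 'r, 'a) struct \<Rightarrow> (nat \<Rightarrow> 'a) \<Rightarrow> 'f trm \<Rightarrow> 'a" where
  "eval_trm M v (Var i) = v i"
| "eval_trm M v (Fn f ts) = fn_interp M f (map (eval_trm M v) ts)"

primrec sat :: "('f, 'r, 'a) struct \<Rightarrow> (nat \<Rightarrow> 'a) \<Rightarrow> ('f, 'r) fm \<Rightarrow> bool" where
  "sat M v (Eq s t) \<longleftrightarrow> eval_trm M v s = eval_trm M v t"
| "sat M v (Rel r ts) \<longleftrightarrow> map (eval_trm M v) ts \<in> rel_interp M r"
| "sat M v (Neg \<phi>) \<longleftrightarrow> \<not> sat M v \<phi>"
| "sat M v (Conj \<phi> \<psi>) \<longleftrightarrow> sat M v \<phi> \<and> sat M v \<psi>"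
| "sat M v (Exists i \<phi>) \<longleftrightarrow> (\<exists>a \<in> univ M. sat M (v(i := a)) \<phi>)"

text \<open>
  The valuation \<open>(!) xs\<close> assigns the \<open>i\<close>-th entry of \<open>xs\<close> to variable \<open>i\<close>. It is unspecified
  beyond the length of \<open>xs\<close>, but is only used for formulas with \<^term>\<open>formula_in L (length xs) \<phi>\<close>.
\<close>

definition extension :: "('f, 'r, 'a) struct \<Rightarrow> nat \<Rightarrow> ('f, 'r) fm \<Rightarrow> 'a list set" where
  "extension M n \<phi> = {xs \<in> nlists n (univ M). sat M ((!) xs) \<phi>}"

definition definable :: "('f, 'r) lang \<Rightarrow> ('f, 'r, 'a) struct \<Rightarrow> nat \<Rightarrow> 'a list set \<Rightarrow> bool" where
  "definable L M n R \<longleftrightarrow> (\<exists>\<phi>. formula_in L n \<phi> \<and> R = extension M n \<phi>)"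

definition automorphism :: "('f, 'r) lang \<Rightarrow> ('f, 'r, 'a) struct \<Rightarrow> ('a \<Rightarrow> 'a) \<Rightarrow> bool" where
  "automorphism L M \<sigma> \<longleftrightarrow>
     bij_betw \<sigma> (univ M) (univ M) \<and>
     (\<forall>f n. fn_arity L f = Some n \<longrightarrow>
        (\<forall>xs \<in> nlists n (univ M). \<sigma> (fn_interp M f xs) = fn_interp M f (map \<sigma> xs))) \<and>
     (\<forall>r n. rel_arity L r = Some n \<longrightarrow>
        (\<forall>xs \<in> nlists n (univ M). xs \<in> rel_interp M r \<longleftrightarrow> map \<sigma> xs \<in> rel_interp M r))"


section \<open>Ultrapowers\<close>

text \<open>
  An ultrafilter on a subset \<open>I\<close> of \<^typ>\<open>'i\<close> corresponds to an ultrafilter on \<^typ>\<open>'i\<close> that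
  contains \<open>I\<close>, with an isomorphic ultrapower, so it suffices to consider ultrafilters on types.
\<close>

definition ultrafilter :: "'i filter \<Rightarrow> bool" where
  "ultrafilter U \<longleftrightarrow> U \<noteq> bot \<and> (\<forall>P. eventually P U \<or> eventually (\<lambda>i. \<not> P i) U)"

definition ultra_eq :: "('f, 'r, 'a) struct \<Rightarrow> 'i filter \<Rightarrow> (('i \<Rightarrow> 'a) \<times> ('i \<Rightarrow> 'a)) set" where
  "ultra_eq M U =
     {(s, t). range s \<subseteq> univ M \<and> range t \<subseteq> univ M \<and> eventually (\<lambda>i. s i = t i) U}"

text \<open>
  In the interpretations, the list \<open>ss\<close> ranges over the lists of representatives of the list \<open>Xs\<close>
  of equivalence classes. The union in the first one is over copies of a single class.
\<close>

definition ultrapower ::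
    "('f, 'r, 'a) struct \<Rightarrow> 'i filter \<Rightarrow> ('f, 'r, ('i \<Rightarrow> 'a) set) struct" where
  "ultrapower M U =
     \<lparr> univ = {s. range s \<subseteq> univ M} // ultra_eq M U,
       fn_interp = (\<lambda>f Xs. \<Union>ss \<in> {ss. list_all2 (\<in>) ss Xs}.
          ultra_eq M U `` {\<lambda>i. fn_interp M f (map (\<lambda>s. s i) ss)}),
       rel_interp = (\<lambda>r. {Xs \<in> lists ({s. range s \<subseteq> univ M} // ultra_eq M U).
          \<exists>ss. list_all2 (\<in>) ss Xs \<and> eventually (\<lambda>i. map (\<lambda>s. s i) ss \<in> rel_interp M r) U}) \<rparr>"


section \<open>Relational structures on powers of a universe\<close>

text \<open>
  An element of \<open>(M\<^sup>d)\<^sup>n\<close> is a list of \<open>n\<close> lists of length \<open>d\<close>; it is identified with an element of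
  \<open>M\<^bsup>d n\<^esup>\<close> by \<^const>\<open>concat\<close>.
\<close>

definition power_definable ::
    "('f, 'r) lang \<Rightarrow> ('f, 'r, 'a) struct \<Rightarrow> nat \<Rightarrow> nat \<Rightarrow> 'a list list set \<Rightarrow> bool" where
  "power_definable L M d n R \<longleftrightarrow>
     R \<subseteq> nlists n (nlists d (univ M)) \<and> definable L M (d * n) (concat ` R)"

definition power_extension ::
    "('f, 'r, 'a) struct \<Rightarrow> nat \<Rightarrow> nat \<Rightarrow> ('f, 'r) fm \<Rightarrow> 'a list list set" where
  "power_extension M d n \<phi> =
     {xs \<in> nlists n (nlists d (univ M)). concat xs \<in> extension M (d * n) \<phi>}"

text \<open>
  The language with relation symbols \<open>Q\<^sub>0, \<dots>, Q\<^sub>k\<^sub>-\<^sub>1\<close>, where \<open>Q\<^sub>i\<close> has arity \<open>ar i\<close>, and the structure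
  \<open>\<langle>M\<^sup>d; Q\<^sub>0, \<dots>, Q\<^sub>k\<^sub>-\<^sub>1\<rangle>\<close>. There are no function symbols.
\<close>

definition rel_lang :: "nat \<Rightarrow> (nat \<Rightarrow> nat) \<Rightarrow> (unit, nat) lang" where
  "rel_lang k ar =
     \<lparr> fn_arity = Map.empty, rel_arity = (\<lambda>i. if i < k then Some (ar i) else None) \<rparr>"

definition power_struct ::
    "('f, 'r, 'a) struct \<Rightarrow> nat \<Rightarrow> (nat \<Rightarrow> 'a list list set) \<Rightarrow> (unit, nat, 'a list) struct" where
  "power_struct M d Q =
     \<lparr> univ = nlists d (univ M), fn_interp = (\<lambda>_ _. undefined), rel_interp = Q \<rparr>"

definition Conc :: "('f, 'r) lang \<Rightarrow> ('f, 'r, 'a) struct \<Rightarrow> 'a list set set" where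
  "Conc L P = {R. \<exists>n \<ge> 1. definable L P n R}"

definition preserved_by :: "('b \<Rightarrow> 'b) set \<Rightarrow> 'b list set \<Rightarrow> bool" where
  "preserved_by H R \<longleftrightarrow> (\<forall>\<alpha> \<in> H. map \<alpha> ` R = R)"


section \<open>Uniformly coded symmetry groups\<close>

definition admissible_codes :: "('f, 'r, 'a) struct \<Rightarrow> nat \<Rightarrow> ('f, 'r) fm \<Rightarrow> 'a list set" where
  "admissible_codes M m D = extension M m D"

text \<open>
  In \<open>\<theta>(x, y, h)\<close>, variables \<open>0, \<dots>, d - 1\<close> stand for \<open>x\<close>, the next \<open>d\<close> variables for \<open>y\<close>,
  and the next \<open>m\<close> for \<open>h\<close>.
\<close>

definition code_graph ::
    "('f, 'r, 'a) struct \<Rightarrow> ('f, 'r) fm \<Rightarrow> 'a list \<Rightarrow> 'a list \<Rightarrow> 'a list \<Rightarrow> bool" where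
  "code_graph M \<theta> h x y \<longleftrightarrow> sat M ((!) (x @ y @ h)) \<theta>"

definition coded_map ::
    "('f, 'r, 'a) struct \<Rightarrow> nat \<Rightarrow> ('f, 'r) fm \<Rightarrow> 'a list \<Rightarrow> 'a list \<Rightarrow> 'a list" where
  "coded_map M d \<theta> h x = (THE y. y \<in> nlists d (univ M) \<and> code_graph M \<theta> h x y)"

definition coded_maps ::
    "('f, 'r, 'a) struct \<Rightarrow> nat \<Rightarrow> nat \<Rightarrow> ('f, 'r) fm \<Rightarrow> ('f, 'r) fm \<Rightarrow> ('a list \<Rightarrow> 'a list) set" where
  "coded_maps M d m D \<theta> = coded_map M d \<theta> ` admissible_codes M m D"

definition coded_symmetry_group ::
    "('f, 'r) lang \<Rightarrow> ('f, 'r, 'a) struct \<Rightarrow> nat \<Rightarrow> nat \<Rightarrow> (nat \<Rightarrow> nat) \<Rightarrow> (nat \<Rightarrow> 'a list list set) \<Rightarrow>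
     nat \<Rightarrow> ('f, 'r) fm \<Rightarrow> ('f, 'r) fm \<Rightarrow> bool" where
  "coded_symmetry_group L M d k ar Q m D \<theta> \<longleftrightarrow>
     (let X = nlists d (univ M); C = admissible_codes M m D; f = coded_map M d \<theta> in
       formula_in L m D \<and> formula_in L (d + d + m) \<theta> \<and>
       (\<forall>h \<in> C. \<exists>g. bij_betw g X X \<and> (\<forall>x \<in> X. \<forall>y \<in> X. code_graph M \<theta> h x y \<longleftrightarrow> y = g x)) \<and>
       (\<forall>h \<in> C. \<forall>i < k. \<forall>xs \<in> nlists (ar i) X. xs \<in> Q i \<longleftrightarrow> map (f h) xs \<in> Q i) \<and>
       (\<exists>e \<in> C. \<forall>x \<in> X. f e x = x) \<and>
       (\<forall>h \<in> C. \<forall>h' \<in> C. \<exists>h'' \<in> C. \<forall>x \<in> X. f h'' x = f h (f h' x)) \<and>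
       (\<forall>h \<in> C. \<exists>h' \<in> C. \<forall>x \<in> X. f h' x = inv_into X (f h) x))"

text \<open>
  Faithfulness with respect to all ultrafilters on the index type \<^typ>\<open>'i\<close>, since HOL cannot
  quantify over all types. The relations of \<open>\<P>(M\<^sup>U)\<close> are given by the formulas \<open>q i\<close>
  that define those of \<open>\<P>\<close> in \<open>M\<close>.
\<close>

definition factorisation_faithful ::
    "'i itself \<Rightarrow> ('f, 'r) lang \<Rightarrow> ('f, 'r, 'a) struct \<Rightarrow> nat \<Rightarrow> nat \<Rightarrow> (nat \<Rightarrow> nat) \<Rightarrow>
     (nat \<Rightarrow> ('f, 'r) fm) \<Rightarrow> nat \<Rightarrow> ('f, 'r) fm \<Rightarrow> ('f, 'r) fm \<Rightarrow> bool" where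
  "factorisation_faithful (_ :: 'i itself) L M d k ar q m D \<theta> \<longleftrightarrow>
     (\<forall>U :: 'i filter. ultrafilter U \<longrightarrow>
       (let N = ultrapower M U in
         \<forall>\<alpha>. automorphism (rel_lang k ar) (power_struct N d (\<lambda>i. power_extension N d (ar i) (q i))) \<alpha> \<longrightarrow>
           (\<exists>h \<in> coded_maps N d m D \<theta>. \<exists>\<sigma>. automorphism L N \<sigma> \<and>
              (\<forall>x \<in> nlists d (univ N). \<alpha> x = h (map \<sigma> x)))))"

text \<open>
  An index type of size at least \<open>2 ^ 2 ^ (\<bar>M\<bar> + \<aleph>\<^sub>0)\<close>. Assuming faithfulness over this single
  index type is weaker than assuming it over all index sets. The type is taken this large
  because for a small index type (a finite one, say, where all ultrapowers are trivial)
  the assumption would carry too little information.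
\<close>

type_synonym 'a ultra_index = "('a + nat) set set set"

end

theory Submission
  imports Defs
begin

text \<open>
  If \<open>R\<close> is not definable in \<open>\<P>\<close>, then for every \<open>m\<close> some tuple in \<open>R\<close> and some tuple outside \<open>R\<close>
  cannot be told apart by \<open>m\<close> back-and-forth steps in \<open>\<P>\<close>; the language of \<open>\<P>\<close> being finite, this needs
  no compactness. An ultrafilter \<open>U\<close> and an automorphism of \<open>\<P>(M\<^sup>U)\<close> that moves the resulting tuple
  of \<open>R\<^sup>U\<close> out of \<open>R\<^sup>U\<close> are then constructed together, following Shelah's proof of the isomorphism
  theorem for ultrapowers (without the continuum hypothesis): along a well-order of length \<open>2\<^sup>I\<close>, one
  pairs up all functions from \<open>I\<close> to \<open>M\<^sup>d\<close> and keeps the filter generated so far independent of almost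
  all members of a family of \<open>2\<^sup>I\<close> functions; an unused member of the family serves as the partner
  of the next function. Because only agreement of both sides, not truth, is put into the filter, an
  arbitrary ultrafilter above the final filter does. By faithfulness and the theorem of Los
  such an automorphism cannot exist when \<open>R\<close> is preserved by \<open>H\<close>.
\<close>

unbundle cardinal_syntax

section \<open>Independent families of functions\<close>

text \<open>For an ultrafilter fixed beforehand, a back-and-forth through 2^|I| functions would need
  saturation over fewer than 2^|I| parameters, while even good ultrafilters provide it in general
  only for |I| many. Hence partners are reserved in advance, as functions whose values are still
  free. A function that merely chooses witnesses is no partner, since each finite list of earlier
  pairs and each level has witnesses of its own; a fresh member of the family can match any one of
  these choices at some index of every set in the filter base. Independence has to hold for |V|
  conditions at a time (V being \<open>'a + nat\<close> in the end), because the counting argument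
  that finds such a member merges one counterexample for each element of the universe into one
  condition. An index stores a map from V to indices and a map from subsets of V to V; with I the
  triple power set of V, both kinds of maps number at most |I|, and the subsets of I label the
  family. The number stored besides is the level to which the starting tuples are required to agree
  at that index.\<close>

lemma card_of_prod_le:
  assumes "infinite (UNIV :: 'z set)" "|UNIV :: 'x set| \<le>o |UNIV :: 'z set|"
    "|UNIV :: 'y set| \<le>o |UNIV :: 'z set|"
  shows "|UNIV :: ('x \<times> 'y) set| \<le>o |UNIV :: 'z set|"
  using card_of_Times_ordLeq_infinite_Field[OF _ assms(2,3) card_of_Card_order] assms(1)
  by (simp add: Field_card_of)

text \<open>This is (2^Z)^X = 2^(X * Z) \<le> 2^Z: a function into the subsets of Z is recorded by
  the pairs (x, z) with z in its value at x, and these pairs are coded in Z.\<close>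

lemma card_of_fun_le:
  assumes "infinite (UNIV :: 'z set)" "|UNIV :: 'x set| \<le>o |UNIV :: 'z set|"
    "|UNIV :: 'y set| \<le>o |UNIV :: 'z set set|"
  shows "|UNIV :: ('x \<Rightarrow> 'y) set| \<le>o |UNIV :: 'z set set|"
proof -
  have "|UNIV :: ('x \<times> 'z) set| \<le>o |UNIV :: 'z set|"
    by (rule card_of_prod_le[OF assms(1,2)]) (rule card_of_mono1, simp)
  then obtain p :: "'x \<times> 'z \<Rightarrow> 'z" where p: "inj p"
    unfolding card_of_ordLeq[symmetric] by blast
  obtain j :: "'y \<Rightarrow> 'z set" where j: "inj j"
    using assms(3) unfolding card_of_ordLeq[symmetric] by blast
  have "inj (\<lambda>f. p ` {(x, z). z \<in> j (f x)})"
  proof (rule injI, rule ext)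
    fix f g :: "'x \<Rightarrow> 'y" and x
    assume "p ` {(x, z). z \<in> j (f x)} = p ` {(x, z). z \<in> j (g x)}"
    then have "{(x, z). z \<in> j (f x)} = {(x, z). z \<in> j (g x)}"
      using p by (simp add: inj_image_eq_iff)
    then have "j (f x) = j (g x)" by blast
    then show "f x = g x" using j by (simp add: inj_eq)
  qed
  then show ?thesis unfolding card_of_ordLeq[symmetric] by blast
qed

lemma card_of_singletons: "|UNIV :: 'x set| \<le>o |UNIV :: 'x set set|"
  by (rule card_of_ordLeqI[of "\<lambda>x. {x}"]) (auto intro: inj_onI)

lemma infinite_sets: "infinite (UNIV :: 'x set) \<Longrightarrow> infinite (UNIV :: 'x set set)"
  by (simp add: Finite_Set.finite_set)

text \<open>
  An index encodes a number \<open>n\<close>, a map \<open>T\<close> from \<open>V\<close> to indices and a map \<open>e\<close> on the power set of \<open>V\<close>;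
  the value of \<open>f X\<close> there is \<open>e (T -` X)\<close> (up to coding of \<open>A\<close> in \<open>V\<close>). At most \<open>|V|\<close> many sets \<open>X\<close> are
  separated by their traces \<open>T -` X\<close> for a suitable \<open>T\<close>, and then \<open>e\<close> prescribes the values.
\<close>

lemma independent_family:
  fixes A :: "'c set"
  assumes inf: "infinite (UNIV :: 'v set)" and "A \<noteq> {}" and "|A| \<le>o |UNIV :: 'v set|"
  obtains f :: "'v set set set set \<Rightarrow> 'v set set set \<Rightarrow> 'c" and t :: "'v set set set \<Rightarrow> nat"
  where "\<And>X i. f X i \<in> A"
    and "\<And>S s n. |S| \<le>o |UNIV :: 'v set| \<Longrightarrow> s ` S \<subseteq> A \<Longrightarrow> \<exists>i. t i = n \<and> (\<forall>X \<in> S. f X i = s X)"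
proof -
  note inf1 = infinite_sets[OF inf] note inf2 = infinite_sets[OF inf1] note inf3 = infinite_sets[OF inf2]
  have v2: "|UNIV :: 'v set| \<le>o |UNIV :: 'v set set set|"
    using card_of_singletons card_of_singletons ordLeq_transitive by blast
  have v3: "|UNIV :: 'v set| \<le>o |UNIV :: 'v set set set set|"
    using v2 card_of_singletons ordLeq_transitive by blast
  have "|UNIV :: nat set| \<le>o |UNIV :: 'v set set set set|"
    using inf3 infinite_iff_card_of_nat by blast
  moreover have "|UNIV :: ('v \<Rightarrow> 'v set set set) set| \<le>o |UNIV :: 'v set set set set|"
    by (rule card_of_fun_le[OF inf2 v2]) (rule card_of_mono1, simp)
  moreover have "|UNIV :: ('v set \<Rightarrow> 'v) set| \<le>o |UNIV :: 'v set set set set|"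
    by (rule card_of_fun_le[OF inf2 card_of_singletons v3])
  ultimately have "|UNIV :: (nat \<times> ('v \<Rightarrow> 'v set set set) \<times> ('v set \<Rightarrow> 'v)) set|
      \<le>o |UNIV :: 'v set set set set|"
    by (intro card_of_prod_le inf3)
  then obtain dec :: "'v set set set \<Rightarrow> nat \<times> ('v \<Rightarrow> 'v set set set) \<times> ('v set \<Rightarrow> 'v)"
    where dec: "surj dec"
    using card_of_ordLeq2[OF UNIV_not_empty] by metis
  obtain dA :: "'v \<Rightarrow> 'c" where dA: "range dA = A"
    using assms(3) card_of_ordLeq2[OF assms(2)] by metis
  have "|UNIV :: ('v \<times> 'v) set| \<le>o |UNIV :: 'v set|"
    by (rule card_of_prod_le[OF inf]) (rule card_of_mono1, simp)+
  then obtain p :: "'v \<Rightarrow> 'v \<times> 'v" where p: "surj p"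
    using card_of_ordLeq2[OF UNIV_not_empty] by metis
  define f where "f X i = (case dec i of (_, T, e) \<Rightarrow> dA (e {v. T v \<in> X}))" for X i
  show thesis
  proof
    show "f X i \<in> A" for X i
      using dA by (auto simp: f_def split: prod.split)
    fix S :: "'v set set set set set" and s n
    assume S: "|S| \<le>o |UNIV :: 'v set|" and s: "s ` S \<subseteq> A"
    obtain \<rho> :: "'v \<Rightarrow> 'v set set set set" where \<rho>: "S \<subseteq> range \<rho>"
      using S card_of_ordLeq2[of S "UNIV :: 'v set"] by (cases "S = {}") auto
    \<comment> \<open>Every pair of members of S is coded, through \<rho>, by some
      \<open>p v\<close>. If the two sets differ, \<open>T v\<close> lies in exactly one of them, so
      |V| points separate all of S.\<close>
    define T where "T v = (SOME z. (z \<in> \<rho> (fst (p v))) \<noteq> (z \<in> \<rho> (snd (p v))))" for v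
    have inj: "inj_on (\<lambda>X. {v. T v \<in> X}) S"
    proof (rule inj_onI, rule ccontr)
      fix X Y assume XY: "X \<in> S" "Y \<in> S" "X \<noteq> Y" and eq: "{v. T v \<in> X} = {v. T v \<in> Y}"
      obtain x y where xy: "X = \<rho> x" "Y = \<rho> y" using XY \<rho> by blast
      obtain v where v: "p v = (x, y)" using p by (metis surj_def)
      have "\<exists>z. (z \<in> X) \<noteq> (z \<in> Y)" using XY by blast
      then have "(T v \<in> X) \<noteq> (T v \<in> Y)"
        unfolding T_def v xy by (simp only: fst_conv snd_conv) (rule someI_ex)
      then show False using eq by blast
    qed
    \<comment> \<open>Inverts the trace map, which is injective on S, and picks a code of the value
      prescribed for the set with trace Z.\<close>
    define e where "e Z = (SOME w. dA w = s (inv_into S (\<lambda>X. {v. T v \<in> X}) Z))" for Z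
    have e: "dA (e {v. T v \<in> X}) = s X" if "X \<in> S" for X
    proof -
      have "\<exists>w. dA w = s X" using that s dA by (metis image_subset_iff imageE)
      then show ?thesis unfolding e_def inv_into_f_f[OF inj that] by (rule someI_ex)
    qed
    obtain i where "dec i = (n, T, e)" using dec by (metis surj_def)
    then show "\<exists>i. (fst \<circ> dec) i = n \<and> (\<forall>X\<in>S. f X i = s X)"
      using e by (intro exI[of _ i]) (simp add: f_def)
  qed
qed

text \<open>Inside each set of E any values can be prescribed for up to |V| functions of the family
  F at once. For directed E this is independence of F modulo the filter generated by E; the empty
  prescription shows that no set of E is empty.\<close>

definition consistent :: "'v set \<Rightarrow> 'c set \<Rightarrow> ('k \<Rightarrow> 'i \<Rightarrow> 'c) \<Rightarrow> 'i set set \<Rightarrow> 'k set \<Rightarrow> bool" where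
  "consistent V A f E F \<longleftrightarrow> (\<forall>e \<in> E. \<forall>S s. S \<subseteq> F \<longrightarrow> |S| \<le>o |V| \<longrightarrow> s ` S \<subseteq> A \<longrightarrow>
     (\<exists>i \<in> e. \<forall>X \<in> S. f X i = s X))"

lemma consistentD:
  assumes "consistent V A f E F" "e \<in> E" "S \<subseteq> F" "|S| \<le>o |V|" "s ` S \<subseteq> A"
  obtains i where "i \<in> e" "\<And>X. X \<in> S \<Longrightarrow> f X i = s X"
  using assms(1)[unfolded consistent_def, rule_format, OF assms(2-5)] that by blast

text \<open>
  Otherwise there would be a maximal family of more than \<open>|B|\<close> counterexamples with pairwise disjoint
  supports, hence \<open>|A|\<close> many with the same \<open>e\<close>. Label these by the elements of \<open>A\<close> and prescribe, in
  addition to their conditions, the label as the value of \<open>f X\<close>: at a point \<open>i\<close> of \<open>e\<close> meeting all this,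
  the counterexample with label \<open>g i\<close> is violated.
\<close>

lemma consistent_predict:
  fixes V :: "'v set" and A :: "'c set" and f :: "'k \<Rightarrow> 'i \<Rightarrow> 'c" and B :: "'b set"
  assumes cons: "consistent V A f E F" and V: "infinite V" "|A| \<le>o |V|"
    and B: "|V| \<le>o |B|" "|E| \<le>o |B|" and g: "\<And>i. g i \<in> A"
  obtains N where "|N| \<le>o |B|"
    and "\<And>e X S s. e \<in> E \<Longrightarrow> X \<in> F - N \<Longrightarrow> S \<subseteq> F - N - {X} \<Longrightarrow> |S| \<le>o |V| \<Longrightarrow> s ` S \<subseteq> A \<Longrightarrow>
      \<exists>i \<in> e. f X i = g i \<and> (\<forall>Y \<in> S. f Y i = s Y)"
proof -
  define failures where "failures = {(e, X, S, s). e \<in> E \<and> X \<in> F \<and> S \<subseteq> F - {X} \<and> |S| \<le>o |V| \<and> s ` S \<subseteq> A \<and>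
    \<not> (\<exists>i \<in> e. f X i = g i \<and> (\<forall>Y \<in> S. f Y i = s Y))}"
  define supp :: "'i set \<times> 'k \<times> 'k set \<times> ('k \<Rightarrow> 'c) \<Rightarrow> 'k set" where
    "supp = (\<lambda>(e, X, S, s). insert X S)"
  define disj where "disj p q \<longleftrightarrow> supp p \<inter> supp q = {}" for p q
  have failures_iff: "(e, X, S, s) \<in> failures \<longleftrightarrow> e \<in> E \<and> X \<in> F \<and> S \<subseteq> F - {X} \<and> |S| \<le>o |V| \<and> s ` S \<subseteq> A \<and>
    \<not> (\<exists>i \<in> e. f X i = g i \<and> (\<forall>Y \<in> S. f Y i = s Y))" for e X S s
    by (simp add: failures_def)
  have supp_simp: "supp (e, X, S, s) = insert X S" for e X S s by (simp add: supp_def)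
  have supp_sub: "supp c \<subseteq> F" "fst c \<in> E" if "c \<in> failures" for c
    using that by (cases c; auto simp: failures_iff supp_simp)+
  have infB: "infinite B" using V(1) B(1) card_of_ordLeq_infinite by blast
  \<comment> \<open>Disjoint supports allow the prescriptions of many counterexamples to be merged
    without conflict, hence a maximal family with this property.\<close>
  have "\<exists>C \<in> {C. C \<subseteq> failures \<and> pairwise disj C}.
      \<forall>X \<in> {C. C \<subseteq> failures \<and> pairwise disj C}. C \<subseteq> X \<longrightarrow> X = C"
  proof (rule subset_Zorn')
    fix \<C> assume "subset.chain {C. C \<subseteq> failures \<and> pairwise disj C} \<C>"
    then have "\<forall>C \<in> \<C>. C \<subseteq> failures \<and> pairwise disj C" "chain\<^sub>\<subseteq> \<C>"
      unfolding subset_chain_def chain_subset_def by blast+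
    then show "\<Union>\<C> \<in> {C. C \<subseteq> failures \<and> pairwise disj C}"
      using pairwise_chain_Union[of \<C> disj] by blast
  qed
  then obtain C where "C \<in> {C. C \<subseteq> failures \<and> pairwise disj C}"
    and max': "\<forall>X \<in> {C. C \<subseteq> failures \<and> pairwise disj C}. C \<subseteq> X \<longrightarrow> X = C"
    by (rule bexE)
  then have C: "C \<subseteq> failures" "pairwise disj C" by simp_all
  have max: "X = C" if "X \<subseteq> failures" "pairwise disj X" "C \<subseteq> X" for X
    using max' that by simp
  have small_supp: "|supp c| \<le>o |V|" if "c \<in> failures" for c
  proof -
    obtain e X S s where c: "c = (e, X, S, s)" by (cases c)
    have "|S| \<le>o |V|" using that unfolding c failures_iff by simp
    then have "|insert X S| \<le>o |V|"
      using V(1) card_of_Un_ordLeq_infinite_Field[of "|V|" "{X}" S] card_of_Card_order[of V]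
        card_of_singl_ordLeq[of V X] by (auto simp: Field_card_of)
    then show ?thesis by (simp add: c supp_simp)
  qed
  have C_e: "|{c \<in> C. fst c = e}| \<le>o |V|" if e: "e \<in> E" for e
  proof (rule ccontr)
    assume "\<not> |{c \<in> C. fst c = e}| \<le>o |V|"
    then have "|V| \<le>o |{c \<in> C. fst c = e}|"
      using ordLeq_total[OF card_of_Well_order card_of_Well_order] by blast
    then have "|A| \<le>o |{c \<in> C. fst c = e}|" using V(2) ordLeq_transitive by blast
    then obtain u where u: "inj_on u A" "u ` A \<subseteq> {c \<in> C. fst c = e}"
      unfolding card_of_ordLeq[symmetric] by blast
    define S where "S = (\<Union>a \<in> A. supp (u a))"
    \<comment> \<open>By disjointness Y lies in the support for only one label a. The projections
      read off the components of \<open>u a\<close>: at its function X the label a itself is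
      prescribed, elsewhere its own condition.\<close>
    define s where "s Y = (let a = (THE a. a \<in> A \<and> Y \<in> supp (u a)) in
      if Y = fst (snd (u a)) then a else snd (snd (snd (u a))) Y)" for Y
    have uf: "u a \<in> failures" "fst (u a) = e" if "a \<in> A" for a using u C that by blast+
    have the: "(THE a. a \<in> A \<and> Y \<in> supp (u a)) = a" if "a \<in> A" "Y \<in> supp (u a)" for a Y
    proof (rule the_equality)
      show "a \<in> A \<and> Y \<in> supp (u a)" using that by blast
      fix b assume b: "b \<in> A \<and> Y \<in> supp (u b)"
      show "b = a"
      proof (rule ccontr)
        assume "b \<noteq> a"
        then have "u b \<noteq> u a" using inj_on_eq_iff[OF u(1)] b that(1) by blast
        then have "disj (u b) (u a)" using pairwiseD[OF C(2)] u(2) b that(1) by blast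
        then show False using b that unfolding disj_def by blast
      qed
    qed
    have S1: "S \<subseteq> F" unfolding S_def using uf(1) supp_sub(1) by (simp add: UN_subset_iff)
    have S2: "|S| \<le>o |V|" unfolding S_def
      by (rule card_of_UNION_ordLeq_infinite[OF V(1,2)]) (simp add: uf(1) small_supp)
    have S3: "s ` S \<subseteq> A"
    proof
      fix y assume "y \<in> s ` S"
      then obtain Y a where a: "y = s Y" "a \<in> A" "Y \<in> supp (u a)" unfolding S_def by blast
      obtain X S' s' where ua: "u a = (e, X, S', s')" using uf(2)[OF a(2)] by (cases "u a") auto
      have "s' ` S' \<subseteq> A" using uf(1)[OF a(2)] unfolding ua failures_iff by simp
      then show "y \<in> A" using a unfolding s_def by (auto simp: the ua supp_simp)
    qed
    obtain i where i: "i \<in> e" "\<And>Y. Y \<in> S \<Longrightarrow> f Y i = s Y"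
      by (rule consistentD[OF cons e S1 S2 S3]) blast
    define a where "a = g i"
    have a: "a \<in> A" using g a_def by simp
    obtain X S' s' where ua: "u a = (e, X, S', s')" using uf(2)[OF a] by (cases "u a") auto
    have sX: "s Y = (if Y = X then a else s' Y)" if "Y \<in> insert X S'" for Y
      unfolding s_def using that by (subst the[OF a]) (auto simp: ua supp_simp Let_def)
    have sub: "insert X S' \<subseteq> S" using a unfolding S_def by (auto simp: ua supp_simp intro!: bexI[of _ a])
    have fail: "\<not> (\<exists>i \<in> e. f X i = g i \<and> (\<forall>Y \<in> S'. f Y i = s' Y))" "X \<notin> S'"
      using uf(1)[OF a] unfolding ua failures_iff by auto
    have "f X i = g i" using i(2)[of X] sX[of X] sub a_def by auto
    moreover have "f Y i = s' Y" if "Y \<in> S'" for Y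
      using i(2)[of Y] sX[of Y] sub that fail(2) by auto
    ultimately show False using fail(1) i(1) by blast
  qed
  have "C = (\<Union>e \<in> E. {c \<in> C. fst c = e})" using C(1) supp_sub(2) by auto
  moreover have "|\<Union>e \<in> E. {c \<in> C. fst c = e}| \<le>o |B|"
    by (rule card_of_UNION_ordLeq_infinite[OF infB B(2)]) (simp add: ordLeq_transitive[OF C_e B(1)])
  ultimately have cC: "|C| \<le>o |B|" by simp
  \<comment> \<open>N is the union of the supports in C. A counterexample outside N has a support
    disjoint from all those in C, so it belongs to C by maximality; then its support, which contains
    X, is disjoint from itself.\<close>
  show thesis
  proof
    show "|\<Union> (supp ` C)| \<le>o |B|"
      by (rule card_of_UNION_ordLeq_infinite[OF infB cC])
        (use C(1) in \<open>auto intro: ordLeq_transitive[OF small_supp B(1)]\<close>)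
    fix e X S s
    assume h: "e \<in> E" "X \<in> F - \<Union> (supp ` C)" "S \<subseteq> F - \<Union> (supp ` C) - {X}" "|S| \<le>o |V|" "s ` S \<subseteq> A"
    show "\<exists>i\<in>e. f X i = g i \<and> (\<forall>Y\<in>S. f Y i = s Y)"
    proof (rule ccontr)
      assume "\<not> ?thesis"
      moreover have "X \<in> F" "S \<subseteq> F - {X}" using h(2,3) by blast+
      ultimately have fl: "(e, X, S, s) \<in> failures" using h(1,4,5) by (simp add: failures_iff)
      have dj: "supp (e, X, S, s) \<inter> supp c = {}" if "c \<in> C" for c
      proof -
        have "supp c \<subseteq> \<Union> (supp ` C)" using that by blast
        moreover have "insert X S \<inter> \<Union> (supp ` C) = {}" using h(2,3) by blast
        ultimately show ?thesis unfolding supp_simp by blast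
      qed
      have "disj (e, X, S, s) c \<and> disj c (e, X, S, s)" if "c \<in> C" for c
        using dj[OF that] unfolding disj_def by (simp add: Int_commute)
      then have "pairwise disj (insert (e, X, S, s) C)"
        using C(2) unfolding pairwise_insert by blast
      then have "insert (e, X, S, s) C = C"
        using fl C(1) by (intro max) blast+
      then have "(e, X, S, s) \<in> C" by blast
      then show False using dj[of "(e, X, S, s)"] by (simp add: supp_simp)
    qed
  qed
qed

section \<open>Back-and-forth equivalence\<close>

text \<open>Ehrenfeucht-Fraisse equivalence to depth n of two tuples of one structure, in the form
  suited to relational languages. Level 0 runs through all index lists \<open>js\<close>,
  repetitions included, and so covers every atomic relation among the entries.\<close>

primrec back_forth :: "('f, 'r) lang \<Rightarrow> ('f, 'r, 'c) struct \<Rightarrow> nat \<Rightarrow> 'c list \<Rightarrow> 'c list \<Rightarrow> bool" where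
  "back_forth L P 0 xs ys \<longleftrightarrow> length xs = length ys \<and>
     (\<forall>i < length xs. \<forall>j < length xs. xs ! i = xs ! j \<longleftrightarrow> ys ! i = ys ! j) \<and>
     (\<forall>r n. rel_arity L r = Some n \<longrightarrow> (\<forall>js \<in> nlists n {..<length xs}.
        map ((!) xs) js \<in> rel_interp P r \<longleftrightarrow> map ((!) ys) js \<in> rel_interp P r))"
| "back_forth L P (Suc n) xs ys \<longleftrightarrow> back_forth L P n xs ys \<and>
     (\<forall>c \<in> univ P. \<exists>c' \<in> univ P. back_forth L P n (xs @ [c]) (ys @ [c'])) \<and>
     (\<forall>c' \<in> univ P. \<exists>c \<in> univ P. back_forth L P n (xs @ [c]) (ys @ [c']))"

lemma back_forth_length: "back_forth L P n xs ys \<Longrightarrow> length xs = length ys"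
  by (induction n) auto

lemma back_forth_antimono: "back_forth L P n xs ys \<Longrightarrow> m \<le> n \<Longrightarrow> back_forth L P m xs ys"
  by (induction n) (auto simp: le_Suc_eq)

lemma back_forth_sym: "back_forth L P n xs ys \<Longrightarrow> back_forth L P n ys xs"
proof (induction n arbitrary: xs ys)
  case 0
  then show ?case by simp
next
  case (Suc n)
  then show ?case unfolding back_forth.simps(2) by meson
qed

text \<open>Positions may be dropped, repeated or permuted: the element added in a step of the game
  gets the index \<open>length xs\<close>, appended to \<open>js\<close>, and the induction
  hypothesis applies to this longer index list.\<close>

lemma back_forth_reindex:
  assumes "back_forth L P n xs ys" "set js \<subseteq> {..<length xs}"
  shows "back_forth L P n (map ((!) xs) js) (map ((!) ys) js)"
  using assms
proof (induction n arbitrary: xs ys js)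
  case 0
  have len: "length xs = length ys" using "0.prems"(1) by simp
  have js: "js ! i < length xs" if "i < length js" for i
    using "0.prems"(2) nth_mem[OF that] by blast
  have "map ((!) (map ((!) xs) js)) is \<in> rel_interp P r \<longleftrightarrow> map ((!) (map ((!) ys) js)) is \<in> rel_interp P r"
    if r: "rel_arity L r = Some m" and "is": "is \<in> nlists m {..<length js}" for r m "is"
  proof -
    have eq: "map ((!) (map ((!) zs) js)) is = map ((!) zs) (map ((!) js) is)" for zs :: "'c list"
      using nlistsE_set[OF "is"] by (auto simp: subset_iff)
    have "map ((!) js) is \<in> nlists m {..<length xs}"
      using nlistsE_length[OF "is"] nlistsE_set[OF "is"] js by (intro nlistsI) auto
    then show ?thesis unfolding eq using "0.prems"(1) r by (simp del: map_map)
  qed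
  then show ?case using "0.prems"(1) js by (simp del: map_map)
next
  case (Suc n)
  have len: "length xs = length ys" using back_forth_length[OF Suc.prems(1)] .
  have app: "back_forth L P n (map ((!) xs) js @ [c]) (map ((!) ys) js @ [c'])"
    if "back_forth L P n (xs @ [c]) (ys @ [c'])" for c c'
  proof -
    have eq: "map ((!) (zs @ [d])) (js @ [length xs]) = map ((!) zs) js @ [d]"
      if "length zs = length xs" for zs :: "'c list" and d
      using Suc.prems(2) that by (auto simp: nth_append)
    have "back_forth L P n (map ((!) (xs @ [c])) (js @ [length xs])) (map ((!) (ys @ [c'])) (js @ [length xs]))"
      using Suc.prems(2) by (intro Suc.IH[OF that]) auto
    then show ?thesis by (simp only: eq[OF refl] eq[OF len[symmetric]])
  qed
  show ?case using Suc.prems Suc.IH[of xs ys js] unfolding back_forth.simps(2) by (meson app)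
qed

section \<open>Agreement sets of finite lists of pairs of functions\<close>

definition agree :: "('f, 'r) lang \<Rightarrow> ('f, 'r, 'c) struct \<Rightarrow> nat \<Rightarrow> (('i \<Rightarrow> 'c) \<times> ('i \<Rightarrow> 'c)) list \<Rightarrow> 'i set" where
  "agree L P n ps = {i. back_forth L P n (map (\<lambda>p. fst p i) ps) (map (\<lambda>p. snd p i) ps)}"

text \<open>A filter base: two lists are joined by appending them and taking the larger level, by
  \<open>agree_antimono\<close>. All levels n are present, so an extension by one pair may cost a
  level.\<close>

definition agreements :: "('f, 'r) lang \<Rightarrow> ('f, 'r, 'c) struct \<Rightarrow> (('i \<Rightarrow> 'c) \<times> ('i \<Rightarrow> 'c)) set \<Rightarrow> 'i set set" where
  "agreements L P S = (\<Union>ps \<in> lists S. range (\<lambda>n. agree L P n ps))"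

text \<open>Every pair in \<open>ps\<close> occurs at some position of \<open>qs\<close>, so the
  tuples for \<open>ps\<close> are reindexings of those for \<open>qs\<close>. Order and
  multiplicity of the pairs are therefore immaterial.\<close>

lemma agree_antimono:
  assumes "set ps \<subseteq> set qs" "n \<le> m"
  shows "agree L P m qs \<subseteq> agree L P n ps"
proof
  fix i assume "i \<in> agree L P m qs"
  then have bf: "back_forth L P n (map (\<lambda>p. fst p i) qs) (map (\<lambda>p. snd p i) qs)"
    unfolding agree_def using back_forth_antimono[OF _ assms(2)] by blast
  have "\<forall>p \<in> set ps. \<exists>j < length qs. qs ! j = p"
    using assms(1) by (auto simp: in_set_conv_nth subset_iff)
  then obtain u where u: "\<And>p. p \<in> set ps \<Longrightarrow> u p < length qs \<and> qs ! u p = p" by metis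
  have eq: "map ((!) (map (\<lambda>p. g p i) qs)) (map u ps) = map (\<lambda>p. g p i) ps" for g :: "_ \<Rightarrow> _ \<Rightarrow> _"
    using u by auto
  have "back_forth L P n (map ((!) (map (\<lambda>p. fst p i) qs)) (map u ps)) (map ((!) (map (\<lambda>p. snd p i) qs)) (map u ps))"
    using u by (intro back_forth_reindex[OF bf]) auto
  then show "i \<in> agree L P n ps" unfolding agree_def eq by simp
qed

text \<open>Back-and-forth equivalence is symmetric. This derives the back step from the forth step
  by exchanging the two sides.\<close>

lemma agreements_swap:
  fixes S :: "(('i \<Rightarrow> 'c) \<times> ('i \<Rightarrow> 'c)) set"
  shows "agreements L P (prod.swap ` S) = agreements L P S"
proof -
  have "agree L P n (map prod.swap ps) = agree L P n ps"
    for n and ps :: "(('i \<Rightarrow> 'c) \<times> ('i \<Rightarrow> 'c)) list"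
    unfolding agree_def by (auto simp: comp_def intro: back_forth_sym)
  then show ?thesis unfolding agreements_def lists_image by (simp add: image_image)
qed

lemma card_of_lists_le:
  fixes S :: "'s set" and B :: "'b set"
  assumes B: "infinite B" and S: "|S| \<le>o |B|"
  shows "|lists S| \<le>o |B|"
proof -
  have nlists: "|nlists n S| \<le>o |B|" for n
  proof (induction n)
    case 0
    have "B \<noteq> {}" using B by auto
    then show ?case using card_of_singl_ordLeq by simp
  next
    case (Suc n)
    have "nlists (Suc n) S = (\<lambda>(x, xs). x # xs) ` (S \<times> nlists n S)"
      by (auto simp: nlists_Suc)
    moreover have "|S \<times> nlists n S| \<le>o |B|"
      using card_of_Times_ordLeq_infinite_Field[OF _ S Suc card_of_Card_order] B
      by (simp add: Field_card_of)
    ultimately show ?case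
      by (simp only:) (rule ordLeq_transitive[OF card_of_image])
  qed
  have natB: "|UNIV :: nat set| \<le>o |B|" using B unfolding infinite_iff_card_of_nat .
  have "lists S = (\<Union>n \<in> UNIV. nlists n S)" unfolding nlists_def lists_eq_set by blast
  then show ?thesis
    by (simp only:) (rule card_of_UNION_ordLeq_infinite[OF B natB], simp add: nlists)
qed

lemma card_of_agreements_le:
  fixes S :: "(('i \<Rightarrow> 'c) \<times> ('i \<Rightarrow> 'c)) set" and B :: "'b set"
  assumes B: "infinite B" and S: "|S| \<le>o |B|"
  shows "|agreements L P S| \<le>o |B|"
proof -
  have "|range (\<lambda>n. agree L P n ps)| \<le>o |B|" for ps :: "(('i \<Rightarrow> 'c) \<times> ('i \<Rightarrow> 'c)) list"
  proof -
    have "|UNIV :: nat set| \<le>o |B|" using B unfolding infinite_iff_card_of_nat .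
    then show ?thesis by (rule ordLeq_transitive[OF card_of_image])
  qed
  then have "\<forall>ps \<in> lists S. |range (\<lambda>n. agree L P n ps)| \<le>o |B|" by blast
  then show ?thesis unfolding agreements_def
    by (rule card_of_UNION_ordLeq_infinite[OF B card_of_lists_le[OF B S]])
qed

text \<open>
  Each \<open>g ps n\<close> picks witnesses for the forth step from \<open>ps\<close>; the new partner \<open>b\<close> is a member of the
  family that can be made equal to every \<open>g ps n\<close>.
\<close>

lemma consistent_forth:
  fixes B :: "'b set" and P :: "('f, 'r, 'c) struct" and f :: "'k \<Rightarrow> 'i \<Rightarrow> 'c"
  assumes cons: "consistent V (univ P) f (agreements L P S) F"
    and V: "infinite V" "|univ P| \<le>o |V|" "|V| \<le>o |B|"
    and S: "|S| \<le>o |B|" and F: "\<not> |F| \<le>o |B|"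
    and f: "\<And>X i. f X i \<in> univ P" and a: "range a \<subseteq> univ P"
  obtains b N where "range b \<subseteq> univ P" "|N| \<le>o |B|"
    "consistent V (univ P) f (agreements L P (insert (a, b) S)) (F - N)"
proof -
  have B: "infinite B" using V(1,3) card_of_ordLeq_infinite by blast
  define good where "good ps n i c \<longleftrightarrow> c \<in> univ P \<and>
    back_forth L P n (map (\<lambda>p. fst p i) ps @ [a i]) (map (\<lambda>p. snd p i) ps @ [c])" for ps n i c
  \<comment> \<open>The fallback \<open>a i\<close> keeps the values in \<open>univ P\<close> at
    indices without a witness, as \<open>consistent_predict\<close> demands.\<close>
  define g where "g ps n i = (if \<exists>c. good ps n i c then SOME c. good ps n i c else a i)" for ps n i
  have good: "good ps n i (g ps n i)" if i: "i \<in> agree L P (Suc n) ps" for ps n i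
  proof -
    have "a i \<in> univ P" using a by blast
    then have "\<exists>c. good ps n i c" using i unfolding agree_def good_def by auto
    then show ?thesis unfolding g_def by (simp add: someI_ex)
  qed
  have g: "g ps n i \<in> univ P" for ps n i
  proof (cases "\<exists>c. good ps n i c")
    case True
    then have "good ps n i (g ps n i)" unfolding g_def by (simp add: someI_ex)
    then show ?thesis unfolding good_def by simp
  next
    case False
    then show ?thesis using a unfolding g_def by auto
  qed
  have "\<exists>N. |N| \<le>o |B| \<and> (\<forall>e X T s. e \<in> agreements L P S \<longrightarrow> X \<in> F - N \<longrightarrow> T \<subseteq> F - N - {X} \<longrightarrow>
      |T| \<le>o |V| \<longrightarrow> s ` T \<subseteq> univ P \<longrightarrow> (\<exists>i \<in> e. f X i = g ps n i \<and> (\<forall>Y \<in> T. f Y i = s Y)))" for ps n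
    by (rule consistent_predict[OF cons V card_of_agreements_le[OF B S], of "g ps n"])
      (use g in auto)
  then obtain N where N: "\<And>ps n. |N ps n| \<le>o |B|"
    "\<And>ps n e X T s. e \<in> agreements L P S \<Longrightarrow> X \<in> F - N ps n \<Longrightarrow> T \<subseteq> F - N ps n - {X} \<Longrightarrow>
      |T| \<le>o |V| \<Longrightarrow> s ` T \<subseteq> univ P \<Longrightarrow> \<exists>i \<in> e. f X i = g ps n i \<and> (\<forall>Y \<in> T. f Y i = s Y)"
    by metis
  \<comment> \<open>Each list and level has its own exceptional set; there are at most |B| of them,
    so a member X of F avoids them all and can follow every \<open>g ps n\<close>.\<close>
  define N0 where "N0 = (\<Union>ps \<in> lists S. \<Union>n. N ps n)"
  have natB: "|UNIV :: nat set| \<le>o |B|" using B unfolding infinite_iff_card_of_nat .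
  have N0: "|N0| \<le>o |B|" unfolding N0_def
    by (intro card_of_UNION_ordLeq_infinite[OF B] card_of_lists_le[OF B S] ballI natB N(1))
  have "\<not> F \<subseteq> N0" using F ordLeq_transitive[OF card_of_mono1 N0] by blast
  then obtain X where X: "X \<in> F" "X \<notin> N0" by blast
  show thesis
  proof
    show "range (f X) \<subseteq> univ P" using f by blast
    have "B \<noteq> {}" using B by auto
    then show "|{X} \<union> N0| \<le>o |B|"
      using card_of_Un_ordLeq_infinite_Field[OF _ card_of_singl_ordLeq N0 card_of_Card_order] B
      by (simp add: Field_card_of)
    show "consistent V (univ P) f (agreements L P (insert (a, f X) S)) (F - ({X} \<union> N0))"
      unfolding consistent_def
    proof (intro ballI allI impI)
      fix e T s
      assume e: "e \<in> agreements L P (insert (a, f X) S)" and T: "T \<subseteq> F - ({X} \<union> N0)"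
        "|T| \<le>o |V|" "s ` T \<subseteq> univ P"
      obtain ps n where ps: "ps \<in> lists (insert (a, f X) S)" and en: "e = agree L P n ps"
        using e unfolding agreements_def by blast
      \<comment> \<open>The old pairs of \<open>ps\<close>, followed by the new pair, cover
        \<open>ps\<close> as a set. Level \<open>Suc n\<close> on \<open>qs\<close> pays for the
        extension: it makes \<open>g qs n i\<close>, which \<open>f X i\<close> equals, an answer to
        \<open>a i\<close> at level n.\<close>
      define qs where "qs = filter (\<lambda>p. p \<in> S) ps"
      have qs: "qs \<in> lists S" unfolding qs_def by auto
      have "set ps \<subseteq> set (qs @ [(a, f X)])" using ps unfolding qs_def by auto
      then have sub: "agree L P n (qs @ [(a, f X)]) \<subseteq> e" unfolding en by (rule agree_antimono) simp
      have "\<exists>i \<in> agree L P (Suc n) qs. f X i = g qs n i \<and> (\<forall>Y \<in> T. f Y i = s Y)"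
      proof (rule N(2)[OF _ _ _ T(2,3)])
        show "agree L P (Suc n) qs \<in> agreements L P S" using qs unfolding agreements_def by blast
        have "N qs n \<subseteq> N0" using qs unfolding N0_def by blast
        then show "X \<in> F - N qs n" "T \<subseteq> F - N qs n - {X}" using X T(1) by blast+
      qed
      then obtain i where i: "i \<in> agree L P (Suc n) qs" "f X i = g qs n i" "\<forall>Y \<in> T. f Y i = s Y"
        by blast
      have "i \<in> agree L P n (qs @ [(a, f X)])"
        using good[OF i(1)] unfolding good_def agree_def i(2)[symmetric] by simp
      then show "\<exists>i \<in> e. \<forall>Y \<in> T. f Y i = s Y" using sub i(3) by blast
    qed
  qed
qed

lemma consistent_back:
  fixes B :: "'b set" and P :: "('f, 'r, 'c) struct" and f :: "'k \<Rightarrow> 'i \<Rightarrow> 'c"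
  assumes cons: "consistent V (univ P) f (agreements L P S) F"
    and V: "infinite V" "|univ P| \<le>o |V|" "|V| \<le>o |B|"
    and S: "|S| \<le>o |B|" and F: "\<not> |F| \<le>o |B|"
    and f: "\<And>X i. f X i \<in> univ P" and b: "range b \<subseteq> univ P"
  obtains a N where "range a \<subseteq> univ P" "|N| \<le>o |B|"
    "consistent V (univ P) f (agreements L P (insert (a, b) S)) (F - N)"
proof -
  have "consistent V (univ P) f (agreements L P (prod.swap ` S)) F"
    using cons by (simp only: agreements_swap)
  moreover have "|prod.swap ` S| \<le>o |B|" using ordLeq_transitive[OF card_of_image S] .
  ultimately obtain a N where aN: "range a \<subseteq> univ P" "|N| \<le>o |B|"
    "consistent V (univ P) f (agreements L P (insert (b, a) (prod.swap ` S))) (F - N)"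
    by (rule consistent_forth[OF _ V _ F f b])
  have "insert (b, a) (prod.swap ` S) = prod.swap ` insert (a, b) S" by simp
  then show thesis using aN that by (simp only: agreements_swap)
qed

text \<open>Choose a preimage of each element; the largest of them bounds all others. In the
  recursion below this brings finitely many pairs back to a single stage, which serves limit stages
  and the final union alike.\<close>

lemma finite_subset_image_under:
  fixes h :: "'k \<Rightarrow> 'x"
  assumes r: "total r" "trans r" "refl r" and "finite T" "T \<noteq> {}" "T \<subseteq> h ` Z"
  obtains y where "y \<in> Z" "T \<subseteq> h ` under r y"
proof -
  have "\<exists>y \<in> Z. T \<subseteq> h ` under r y"
    using assms(4-6)
  proof (induction rule: finite_ne_induct)
    case (singleton x)
    then obtain y where "y \<in> Z" "x = h y" by blast
    moreover have "y \<in> under r y" using r(3) unfolding refl_on_def under_def by blast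
    ultimately show ?case by blast
  next
    case (insert x T)
    then obtain y z where yz: "y \<in> Z" "T \<subseteq> h ` under r y" "z \<in> Z" "x = h z" by blast
    have zz: "z \<in> under r z" using r(3) unfolding refl_on_def under_def by blast
    have "(y, z) \<in> r \<or> (z, y) \<in> r"
      using r(1,3) unfolding total_on_def refl_on_def by (cases "y = z") auto
    then show ?case
    proof
      assume "(y, z) \<in> r"
      then have "under r y \<subseteq> under r z" using r(2) unfolding under_def trans_def by blast
      then show ?thesis using yz zz by blast
    next
      assume "(z, y) \<in> r"
      then have "z \<in> under r y" unfolding under_def by simp
      then show ?thesis using yz by blast
    qed
  qed
  then show thesis using that by blast
qed

text \<open>The recursion runs along the cardinal order of the label set K of the family, so fewer
  than |K| stages precede each stage. They have produced too few pairs, and spent too few members of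
  the family, to prevent a further forth or back step.\<close>

lemma coupling_exists:
  fixes P :: "('f, 'r, 'c) struct" and f :: "'k \<Rightarrow> 'i \<Rightarrow> 'c" and V :: "'v set"
  defines "X \<equiv> {a :: 'i \<Rightarrow> 'c. range a \<subseteq> univ P}"
  assumes V: "infinite V" "|univ P| \<le>o |V|" "|V| \<le>o |UNIV :: 'i set|"
    and K: "|UNIV :: 'i set| <o |UNIV :: 'k set|"
    and f: "\<And>Y i. f Y i \<in> univ P"
    and enum: "X \<times> UNIV \<subseteq> range (enum :: 'k \<Rightarrow> ('i \<Rightarrow> 'c) \<times> bool)"
    and S0: "|S0| \<le>o |UNIV :: 'i set|" "S0 \<subseteq> X \<times> X"
    and cons: "consistent V (univ P) f (agreements L P S0) UNIV"
  obtains S where "S0 \<subseteq> S" "S \<subseteq> X \<times> X" "fst ` S = X" "snd ` S = X" "{} \<notin> agreements L P S"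
proof -
  define r where "r = |UNIV :: 'k set|"
  have "Well_order r" "Field r = UNIV" unfolding r_def
    by (rule card_of_Well_order, rule Field_card_of)
  then have r: "total r" "trans r" "refl r" "antisym r" "wf (r - Id)"
    unfolding well_order_on_def linear_order_on_def partial_order_on_def preorder_on_def by simp_all
  have underS_iff: "y \<in> underS r x \<longleftrightarrow> (y, x) \<in> r - Id" for x y
    unfolding underS_def by auto
  have underS_mono: "underS r y \<subseteq> underS r x" "under r y \<subseteq> underS r x" if "y \<in> underS r x" for x y
    using that r(2,4) unfolding underS_def under_def trans_def antisym_def by blast+
  have under_eq: "under r y = insert y (underS r y)" for y
    using r(3) unfolding underS_def under_def refl_on_def by blast
  \<comment> \<open>A bound for everything used before stage x: infinite, at least |I|, growing with
    x, and still smaller than K.\<close>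
  define B where "B x = (UNIV :: 'i set) <+> underS r x" for x
  have I: "infinite (UNIV :: 'i set)" using V(1,3) card_of_ordLeq_infinite by blast
  have Kinf: "infinite (UNIV :: 'k set)"
    using card_of_ordLeq_infinite[OF ordLess_imp_ordLeq[OF K] I] .
  have I_B: "|UNIV :: 'i set| \<le>o |B x|" for x unfolding B_def by (rule card_of_Plus1)
  have u_B: "|underS r x| \<le>o |B x|" for x unfolding B_def by (rule card_of_Plus2)
  have Binf: "infinite (B x)" for x using card_of_ordLeq_infinite[OF I_B I] .
  have B_mono: "|B y| \<le>o |B x|" if "y \<in> underS r x" for x y
    unfolding B_def by (rule card_of_Plus_mono2, rule card_of_mono1, rule underS_mono(1)[OF that])
  have B_K: "|B x| <o |UNIV :: 'k set|" for x
  proof -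
    have "|underS r x| <o r" unfolding r_def
      by (rule card_of_underS[OF card_of_Card_order]) (simp add: Field_card_of)
    then show ?thesis unfolding B_def r_def by (rule card_of_Plus_ordLess_infinite[OF Kinf K])
  qed
  have Un_B: "|C \<union> C'| \<le>o |B x|" if "|C| \<le>o |B x|" "|C'| \<le>o |B x|" for C C' :: "'z set" and x
    using card_of_Un_ordLeq_infinite_Field[OF _ that card_of_Card_order] Binf by (simp add: Field_card_of)
  define before :: "('k \<Rightarrow> (('i \<Rightarrow> 'c) \<times> ('i \<Rightarrow> 'c)) \<times> 'k set) \<Rightarrow> 'k \<Rightarrow> (('i \<Rightarrow> 'c) \<times> ('i \<Rightarrow> 'c)) set"
    where "before h x = S0 \<union> (\<lambda>y. fst (h y)) ` underS r x" for h x
  define free :: "('k \<Rightarrow> (('i \<Rightarrow> 'c) \<times> ('i \<Rightarrow> 'c)) \<times> 'k set) \<Rightarrow> 'k \<Rightarrow> 'k set"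
    where "free h x = UNIV - (\<Union>y \<in> underS r x. snd (h y))" for h x
  \<comment> \<open>The second component of p collects the members of the family spent at x. The
    Boolean in \<open>enum x\<close> says on which side of the new pair the listed function has to
    stand.\<close>
  define stage where "stage h x p \<longleftrightarrow> fst p \<in> X \<times> X \<and> |snd p| \<le>o |B x| \<and>
    (\<forall>a \<in> X. enum x = (a, True) \<longrightarrow> fst (fst p) = a) \<and>
    (\<forall>a \<in> X. enum x = (a, False) \<longrightarrow> snd (fst p) = a) \<and>
    consistent V (univ P) f (agreements L P (insert (fst p) (before h x))) (free h x - snd p)" for h x p
  have cong: "before h x = before h' x" "free h x = free h' x"
    if "\<And>y. (y, x) \<in> r - Id \<Longrightarrow> h y = h' y" for h h' x
    using that unfolding before_def free_def underS_iff[symmetric] by auto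
  have "\<exists>h. \<forall>x. stage h x (h x)"
  proof (rule dependent_wf_choice[OF r(5)])
    show "stage h x p = stage h' x p" if "\<And>y. (y, x) \<in> r - Id \<Longrightarrow> h y = h' y" for h h' x p
      unfolding stage_def by (simp only: cong[OF that])
    fix x h assume "\<And>y. (y, x) \<in> r - Id \<Longrightarrow> stage h y (h y)"
    then have IH: "stage h y (h y)" if "y \<in> underS r x" for y
      using that unfolding underS_iff by blast
    \<comment> \<open>Successor and limit stages need no distinction: a finite list of earlier pairs
      lies in S0 or was complete after one earlier stage y, and \<open>free h x\<close> is contained
      in what stage y left over.\<close>
    have cons_x: "consistent V (univ P) f (agreements L P (before h x)) (free h x)"
      unfolding consistent_def
    proof (intro ballI allI impI)
      fix e T s
      assume e: "e \<in> agreements L P (before h x)" and T: "T \<subseteq> free h x" "|T| \<le>o |V|" "s ` T \<subseteq> univ P"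
      obtain ps n where ps: "ps \<in> lists (before h x)" and en: "e = agree L P n ps"
        using e unfolding agreements_def by blast
      show "\<exists>i \<in> e. \<forall>Y \<in> T. f Y i = s Y"
      proof (cases "set ps \<subseteq> S0")
        case True
        then have "e \<in> agreements L P S0" unfolding en agreements_def by auto
        then show ?thesis using consistentD[OF cons _ subset_UNIV T(2,3)] by metis
      next
        case False
        have "set ps - S0 \<subseteq> (\<lambda>y. fst (h y)) ` underS r x" using ps unfolding before_def by auto
        moreover have "finite (set ps - S0)" "set ps - S0 \<noteq> {}" using False by auto
        ultimately obtain y where y: "y \<in> underS r x" "set ps - S0 \<subseteq> (\<lambda>y. fst (h y)) ` under r y"
          using finite_subset_image_under[OF r(1-3)] by metis
        have "set ps \<subseteq> insert (fst (h y)) (before h y)"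
          using y(2) unfolding under_eq before_def by auto
        then have "e \<in> agreements L P (insert (fst (h y)) (before h y))"
          unfolding en agreements_def by auto
        moreover have "T \<subseteq> free h y - snd (h y)"
          using T(1) y(1) underS_mono(1)[OF y(1)] unfolding free_def by blast
        moreover have "consistent V (univ P) f (agreements L P (insert (fst (h y)) (before h y))) (free h y - snd (h y))"
          using IH[OF y(1)] unfolding stage_def by blast
        ultimately show ?thesis using consistentD[OF _ _ _ T(2,3)] by metis
      qed
    qed
    have S: "|before h x| \<le>o |B x|" unfolding before_def
      by (intro Un_B ordLeq_transitive[OF S0(1) I_B] ordLeq_transitive[OF card_of_image u_B])
    \<comment> \<open>Otherwise the free members together with those spent earlier would number at
      most |B x|, although they make up all of K.\<close>
    have free: "\<not> |free h x| \<le>o |B x|"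
    proof
      assume le: "|free h x| \<le>o |B x|"
      have "|snd (h y)| \<le>o |B x|" if "y \<in> underS r x" for y
        using IH[OF that] ordLeq_transitive[OF _ B_mono[OF that]] unfolding stage_def by blast
      then have "|\<Union>y \<in> underS r x. snd (h y)| \<le>o |B x|"
        by (intro card_of_UNION_ordLeq_infinite[OF Binf u_B]) blast
      then have "|free h x \<union> (\<Union>y \<in> underS r x. snd (h y))| \<le>o |B x|" by (rule Un_B[OF le])
      then have "|UNIV :: 'k set| \<le>o |B x|" unfolding free_def by simp
      then show False using B_K not_ordLess_ordLeq by blast
    qed
    note V' = V(1,2) ordLeq_transitive[OF V(3) I_B[of x]]
    obtain c z where cz: "enum x = (c, z)" by (cases "enum x")
    show "\<exists>p. stage h x p"
    proof (cases "c \<in> X")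
      \<comment> \<open>The entry listed at x is not a function into \<open>univ P\<close> and
        imposes no task; \<open>f x\<close> is put on the left so that some pair is added.\<close>
      case False
      have fx: "range (f x) \<subseteq> univ P" using f by blast
      obtain b N where "range b \<subseteq> univ P" "|N| \<le>o |B x|"
        "consistent V (univ P) f (agreements L P (insert (f x, b) (before h x))) (free h x - N)"
        by (rule consistent_forth[OF cons_x V' S free f fx])
      then have "stage h x ((f x, b), N)" using False fx unfolding stage_def cz X_def by auto
      then show ?thesis by blast
    next
      case True
      then have c: "range c \<subseteq> univ P" unfolding X_def by simp
      show ?thesis
      proof (cases z)
        case z: True
        obtain b N where "range b \<subseteq> univ P" "|N| \<le>o |B x|"
          "consistent V (univ P) f (agreements L P (insert (c, b) (before h x))) (free h x - N)"
          by (rule consistent_forth[OF cons_x V' S free f c])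
        then have "stage h x ((c, b), N)" using z c unfolding stage_def cz X_def by auto
        then show ?thesis by blast
      next
        case z: False
        obtain a N where "range a \<subseteq> univ P" "|N| \<le>o |B x|"
          "consistent V (univ P) f (agreements L P (insert (a, c) (before h x))) (free h x - N)"
          by (rule consistent_back[OF cons_x V' S free f c])
        then have "stage h x ((a, c), N)" using z c unfolding stage_def cz X_def by auto
        then show ?thesis by blast
      qed
    qed
  qed
  then obtain h where h: "\<And>x. stage h x (h x)" by blast
  define S where "S = S0 \<union> range (\<lambda>x. fst (h x))"
  have fst_h: "fst (h x) \<in> X \<times> X" for x using h[of x] unfolding stage_def by blast
  show thesis
  proof
    show "S0 \<subseteq> S" unfolding S_def by blast
    show SX: "S \<subseteq> X \<times> X" unfolding S_def using S0(2) fst_h by blast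
    have "X \<subseteq> fst ` S"
    proof
      fix a assume a: "a \<in> X"
      then have "(a, True) \<in> range enum" using enum by blast
      then obtain x where x: "enum x = (a, True)" by (metis imageE)
      have "fst (fst (h x)) = a" using h[of x] a x unfolding stage_def by blast
      then show "a \<in> fst ` S" unfolding S_def by force
    qed
    then show "fst ` S = X" using SX by auto
    have "X \<subseteq> snd ` S"
    proof
      fix a assume a: "a \<in> X"
      then have "(a, False) \<in> range enum" using enum by blast
      then obtain x where x: "enum x = (a, False)" by (metis imageE)
      have "snd (fst (h x)) = a" using h[of x] a x unfolding stage_def by blast
      then show "a \<in> snd ` S" unfolding S_def by force
    qed
    then show "snd ` S = X" using SX by auto
    \<comment> \<open>An empty agreement set would involve finitely many pairs only, hence occur at
      some stage, where the empty prescription already yields a point.\<close>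
    show "{} \<notin> agreements L P S"
    proof
      assume "{} \<in> agreements L P S"
      then obtain ps n where ps: "ps \<in> lists S" and en: "{} = agree L P n ps"
        unfolding agreements_def by blast
      have "\<exists>y. set ps \<subseteq> insert (fst (h y)) (before h y)"
      proof (cases "set ps \<subseteq> S0")
        case True
        then show ?thesis unfolding before_def by blast
      next
        case False
        have "set ps - S0 \<subseteq> range (\<lambda>y. fst (h y))" using ps unfolding S_def by auto
        moreover have "finite (set ps - S0)" "set ps - S0 \<noteq> {}" using False by auto
        ultimately obtain y where "set ps - S0 \<subseteq> (\<lambda>y. fst (h y)) ` under r y"
          using finite_subset_image_under[OF r(1-3)] by metis
        then have "set ps \<subseteq> insert (fst (h y)) (before h y)" unfolding under_eq before_def by auto
        then show ?thesis by blast
      qed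
      then obtain y where "set ps \<subseteq> insert (fst (h y)) (before h y)" by blast
      then have "{} \<in> agreements L P (insert (fst (h y)) (before h y))"
        unfolding en agreements_def by auto
      moreover have "consistent V (univ P) f (agreements L P (insert (fst (h y)) (before h y))) (free h y - snd (h y))"
        using h[of y] unfolding stage_def by blast
      ultimately show False
        using consistentD[of V "univ P" f _ _ "{}" "{}"] card_of_empty by (metis empty_iff empty_subsetI image_empty)
    qed
  qed
qed

section \<open>Automorphisms and definable sets\<close>

lemma eval_trm_cong: "(\<And>i. i \<in> fv_trm t \<Longrightarrow> v i = w i) \<Longrightarrow> eval_trm M v t = eval_trm M w t"
proof (induction t)
  case (Fn f ts)
  then have "map (eval_trm M v) ts = map (eval_trm M w) ts" by auto
  then show ?case by (simp only: eval_trm.simps)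
qed simp

lemma sat_cong: "(\<And>i. i \<in> fv_fm \<phi> \<Longrightarrow> v i = w i) \<Longrightarrow> sat M v \<phi> \<longleftrightarrow> sat M w \<phi>"
proof (induction \<phi> arbitrary: v w)
  case (Eq s t)
  have "eval_trm M v s = eval_trm M w s" "eval_trm M v t = eval_trm M w t"
    using Eq by (auto intro: eval_trm_cong)
  then show ?case by simp
next
  case (Rel r ts)
  have "map (eval_trm M v) ts = map (eval_trm M w) ts"
    using Rel by (auto intro: eval_trm_cong)
  then show ?case by (simp only: sat.simps)
next
  case (Neg \<phi>)
  have "sat M v \<phi> = sat M w \<phi>" by (rule Neg.IH) (simp add: Neg.prems)
  then show ?case by simp
next
  case (Conj \<phi> \<psi>)
  have "sat M v \<phi> = sat M w \<phi>" by (rule Conj.IH(1)) (simp add: Conj.prems)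
  moreover have "sat M v \<psi> = sat M w \<psi>" by (rule Conj.IH(2)) (simp add: Conj.prems)
  ultimately show ?case by simp
next
  case (Exists i \<phi>)
  have "sat M (v(i := a)) \<phi> = sat M (w(i := a)) \<phi>" for a
    by (rule Exists.IH) (simp add: Exists.prems)
  then show ?case by simp
qed

lemma eval_trm_closed:
  assumes "is_structure L M" "range v \<subseteq> univ M" "wf_trm L t"
  shows "eval_trm M v t \<in> univ M"
  using assms(3)
proof (induction t)
  case (Var i)
  then show ?case using assms(2) by auto
next
  case (Fn f ts)
  then have "map (eval_trm M v) ts \<in> nlists (length ts) (univ M)"
    by (intro nlistsI) (auto simp: list_all_iff)
  then show ?case using Fn.prems assms(1) unfolding is_structure_def by auto
qed

lemma eval_trm_automorphism:
  assumes "is_structure L M" "automorphism L M \<sigma>" "range v \<subseteq> univ M" "wf_trm L t"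
  shows "eval_trm M (\<lambda>i. \<sigma> (v i)) t = \<sigma> (eval_trm M v t)"
  using assms(4)
proof (induction t)
  case (Fn f ts)
  have "map (eval_trm M v) ts \<in> nlists (length ts) (univ M)"
    using Fn.prems by (intro nlistsI) (auto simp: list_all_iff intro!: eval_trm_closed[OF assms(1,3)])
  moreover have "map (eval_trm M (\<lambda>i. \<sigma> (v i))) ts = map \<sigma> (map (eval_trm M v) ts)"
    using Fn.prems by (auto simp: list_all_iff Fn.IH)
  ultimately show ?case
    using Fn.prems assms(2) unfolding automorphism_def by (simp del: map_map)
qed simp

lemma sat_automorphism:
  assumes "is_structure L M" "automorphism L M \<sigma>" "range v \<subseteq> univ M" "wf_fm L \<phi>"
  shows "sat M (\<lambda>i. \<sigma> (v i)) \<phi> \<longleftrightarrow> sat M v \<phi>"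
  using assms(3,4)
proof (induction \<phi> arbitrary: v)
  case (Eq s t)
  have "inj_on \<sigma> (univ M)" using assms(2) unfolding automorphism_def bij_betw_def by blast
  then show ?case
    using Eq eval_trm_closed[OF assms(1)] by (simp add: eval_trm_automorphism[OF assms(1,2)] inj_on_eq_iff)
next
  case (Rel r ts)
  have "map (eval_trm M v) ts \<in> nlists (length ts) (univ M)"
    using Rel by (intro nlistsI) (auto simp: list_all_iff intro!: eval_trm_closed[OF assms(1)])
  moreover have "map (eval_trm M (\<lambda>i. \<sigma> (v i))) ts = map \<sigma> (map (eval_trm M v) ts)"
    using Rel by (auto simp: list_all_iff eval_trm_automorphism[OF assms(1,2)])
  ultimately show ?case
    using Rel.prems assms(2) unfolding automorphism_def by (simp del: map_map)
next
  case (Exists i \<phi>)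
  have bij: "\<sigma> ` univ M = univ M" using assms(2) unfolding automorphism_def bij_betw_def by blast
  have upd: "(\<lambda>j. \<sigma> (v j))(i := \<sigma> a) = (\<lambda>j. \<sigma> ((v(i := a)) j))" for a by auto
  have "(\<exists>b \<in> univ M. sat M ((\<lambda>i. \<sigma> (v i))(i := b)) \<phi>) \<longleftrightarrow> (\<exists>a \<in> univ M. sat M ((\<lambda>i. \<sigma> (v i))(i := \<sigma> a)) \<phi>)"
    using bij by (metis imageE imageI)
  also have "\<dots> \<longleftrightarrow> (\<exists>a \<in> univ M. sat M (v(i := a)) \<phi>)"
  proof (rule bex_cong[OF refl])
    fix a assume "a \<in> univ M"
    then show "sat M ((\<lambda>i. \<sigma> (v i))(i := \<sigma> a)) \<phi> \<longleftrightarrow> sat M (v(i := a)) \<phi>"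
      unfolding upd using Exists.prems by (intro Exists.IH) auto
  qed
  finally show ?case by simp
qed simp_all

lemma extension_automorphism:
  assumes "is_structure L M" "automorphism L M \<sigma>" "formula_in L n \<phi>" "xs \<in> nlists n (univ M)"
  shows "map \<sigma> xs \<in> extension M n \<phi> \<longleftrightarrow> xs \<in> extension M n \<phi>"
proof -
  obtain c where c: "c \<in> univ M" using assms(1) unfolding is_structure_def by blast
  \<comment> \<open>The valuation \<open>(!) xs\<close> is unspecified beyond position n, whereas
    \<open>sat_automorphism\<close> asks for one with all values in the universe; c fills the
    gap.\<close>
  define v where "v i = (if i < n then xs ! i else c)" for i
  have v: "range v \<subseteq> univ M" using c assms(4) unfolding v_def by (auto simp: nlistsE_nth_in)
  have fv: "fv_fm \<phi> \<subseteq> {..<n}" using assms(3) unfolding formula_in_def by blast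
  have len: "length xs = n" using assms(4) by simp
  have "sat M ((!) xs) \<phi> \<longleftrightarrow> sat M v \<phi>" using fv by (intro sat_cong) (auto simp: v_def)
  moreover have "sat M ((!) (map \<sigma> xs)) \<phi> \<longleftrightarrow> sat M (\<lambda>i. \<sigma> (v i)) \<phi>"
    using fv len by (intro sat_cong) (auto simp: v_def)
  moreover have "sat M (\<lambda>i. \<sigma> (v i)) \<phi> \<longleftrightarrow> sat M v \<phi>"
    using assms(3) unfolding formula_in_def by (intro sat_automorphism[OF assms(1,2) v]) blast
  moreover have "map \<sigma> xs \<in> nlists n (univ M)"
    using assms(2) nlistsE_length[OF assms(4)] nlistsE_set[OF assms(4)]
    unfolding automorphism_def bij_betw_def by (intro nlistsI) auto
  ultimately show ?thesis using assms(4) unfolding extension_def by simp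
qed

section \<open>Closure properties of definable sets and sets determined by finitely many of
  them\<close>

lemma definable_UNIV: "definable L M n (nlists n (univ M))"
proof -
  \<comment> \<open>The formula has to be closed because n may be 0, when no variable may occur
    free.\<close>
  let ?\<phi> = "Neg (Exists 0 (Neg (Eq (Var 0) (Var 0))))"
  have "formula_in L n ?\<phi>" "extension M n ?\<phi> = nlists n (univ M)"
    by (auto simp: formula_in_def extension_def)
  then show ?thesis unfolding definable_def by metis
qed

lemma definable_Diff:
  assumes "definable L M n R"
  shows "definable L M n (nlists n (univ M) - R)"
proof -
  obtain \<phi> where "formula_in L n \<phi>" "R = extension M n \<phi>" using assms unfolding definable_def by blast
  then have "formula_in L n (Neg \<phi>)" "nlists n (univ M) - R = extension M n (Neg \<phi>)"
    by (auto simp: formula_in_def extension_def)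
  then show ?thesis unfolding definable_def by blast
qed

lemma definable_Int:
  assumes "definable L M n R" "definable L M n S"
  shows "definable L M n (R \<inter> S)"
proof -
  obtain \<phi> \<psi> where "formula_in L n \<phi>" "R = extension M n \<phi>" "formula_in L n \<psi>" "S = extension M n \<psi>"
    using assms unfolding definable_def by blast
  then have "formula_in L n (Conj \<phi> \<psi>)" "R \<inter> S = extension M n (Conj \<phi> \<psi>)"
    by (auto simp: formula_in_def extension_def)
  then show ?thesis unfolding definable_def by blast
qed

lemma definable_subset: "definable L M n R \<Longrightarrow> R \<subseteq> nlists n (univ M)"
  unfolding definable_def extension_def by blast

lemma definable_Un:
  assumes "definable L M n R" "definable L M n S"
  shows "definable L M n (R \<union> S)"
proof -
  have "R \<union> S = nlists n (univ M) - ((nlists n (univ M) - R) \<inter> (nlists n (univ M) - S))"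
    using definable_subset[OF assms(1)] definable_subset[OF assms(2)] by blast
  then show ?thesis using assms by (metis definable_Diff definable_Int)
qed

lemma definable_UN:
  assumes "finite I" "\<And>i. i \<in> I \<Longrightarrow> definable L M n (R i)"
  shows "definable L M n (\<Union>i \<in> I. R i)"
  using assms
proof (induction rule: finite_induct)
  case empty
  then show ?case using definable_Diff[OF definable_UNIV] by (metis Diff_cancel Sup_empty image_empty)
next
  case (insert i I)
  then show ?case by (simp add: definable_Un)
qed

lemma definable_projection:
  assumes "definable L M (Suc n) R"
  shows "definable L M n {xs \<in> nlists n (univ M). \<exists>c \<in> univ M. xs @ [c] \<in> R}"
proof -
  obtain \<phi> where \<phi>: "formula_in L (Suc n) \<phi>" "R = extension M (Suc n) \<phi>"
    using assms unfolding definable_def by blast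
  have "sat M (((!) xs)(n := c)) \<phi> \<longleftrightarrow> sat M ((!) (xs @ [c])) \<phi>" if "length xs = n" for xs c
    using \<phi>(1) that by (intro sat_cong) (auto simp: formula_in_def nth_append less_Suc_eq)
  moreover have "xs @ [c] \<in> nlists (Suc n) (univ M)" if "xs \<in> nlists n (univ M)" "c \<in> univ M" for xs c
    using nlistsE_length[OF that(1)] nlistsE_set[OF that(1)] that(2) by (intro nlistsI) auto
  ultimately have "{xs \<in> nlists n (univ M). \<exists>c \<in> univ M. xs @ [c] \<in> R} = extension M n (Exists n \<phi>)"
    unfolding \<phi>(2) extension_def by (intro Collect_cong) auto
  moreover have "formula_in L n (Exists n \<phi>)"
    using \<phi>(1) by (auto simp: formula_in_def lessThan_Suc)
  ultimately show ?thesis unfolding definable_def by blast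
qed

lemma definable_eq:
  assumes "i < n" "j < n"
  shows "definable L M n {xs \<in> nlists n (univ M). xs ! i = xs ! j}"
proof -
  have "formula_in L n (Eq (Var i) (Var j))" using assms by (simp add: formula_in_def)
  moreover have "{xs \<in> nlists n (univ M). xs ! i = xs ! j} = extension M n (Eq (Var i) (Var j))"
    by (simp add: extension_def)
  ultimately show ?thesis unfolding definable_def by blast
qed

lemma definable_rel:
  assumes "rel_arity L r = Some m" "js \<in> nlists m {..<n}"
  shows "definable L M n {xs \<in> nlists n (univ M). map ((!) xs) js \<in> rel_interp M r}"
proof -
  have "length js = m" "set js \<subseteq> {..<n}" using nlistsE_length[OF assms(2)] nlistsE_set[OF assms(2)] by simp_all
  then have "formula_in L n (Rel r (map Var js))"
    using assms(1) by (auto simp: formula_in_def list_all_iff)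
  moreover have "{xs \<in> nlists n (univ M). map ((!) xs) js \<in> rel_interp M r} = extension M n (Rel r (map Var js))"
    by (simp add: extension_def comp_def)
  ultimately show ?thesis unfolding definable_def by blast
qed

text \<open>The atoms, possibly empty, of the Boolean algebra generated by \<S> on X; \<T> records
  which members of \<S> contain the points.\<close>

definition cell :: "'x set \<Rightarrow> 'x set set \<Rightarrow> 'x set set \<Rightarrow> 'x set" where
  "cell X \<S> \<T> = {x \<in> X. \<forall>S \<in> \<S>. x \<in> S \<longleftrightarrow> S \<in> \<T>}"

lemma definable_cell:
  assumes "finite \<S>" "\<And>S. S \<in> \<S> \<Longrightarrow> definable L M n S"
  shows "definable L M n (cell (nlists n (univ M)) \<S> \<T>)"
  using assms
proof (induction rule: finite_induct)
  case empty
  then show ?case by (simp add: cell_def definable_UNIV)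
next
  case (insert S \<S>)
  let ?X = "nlists n (univ M)"
  have S: "definable L M n S" using insert.prems by blast
  have "cell ?X (insert S \<S>) \<T> = cell ?X \<S> \<T> \<inter> (if S \<in> \<T> then S else ?X - S)"
    using definable_subset[OF S] by (auto simp: cell_def)
  moreover have "definable L M n (if S \<in> \<T> then S else ?X - S)"
    using S definable_Diff[OF S] by simp
  moreover have "definable L M n (cell ?X \<S> \<T>)" using insert.IH insert.prems by blast
  ultimately show ?case using definable_Int by metis
qed

text \<open>R is the union of the cells that it meets, and finitely many sets have only finitely
  many membership patterns.\<close>

lemma definable_if_determined:
  assumes fin: "finite \<S>" and def: "\<And>S. S \<in> \<S> \<Longrightarrow> definable L M n S"
    and R: "R \<subseteq> nlists n (univ M)"
    and det: "\<And>xs ys. xs \<in> R \<Longrightarrow> ys \<in> nlists n (univ M) \<Longrightarrow> (\<forall>S \<in> \<S>. xs \<in> S \<longleftrightarrow> ys \<in> S) \<Longrightarrow> ys \<in> R"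
  shows "definable L M n R"
proof -
  let ?I = "(\<lambda>xs. {S \<in> \<S>. xs \<in> S}) ` R" and ?X = "nlists n (univ M)"
  have "R = (\<Union>\<T> \<in> ?I. cell ?X \<S> \<T>)"
  proof (intro equalityI subsetI)
    fix xs assume "xs \<in> R"
    then show "xs \<in> (\<Union>\<T> \<in> ?I. cell ?X \<S> \<T>)" using R by (auto simp: cell_def)
  next
    fix ys assume "ys \<in> (\<Union>\<T> \<in> ?I. cell ?X \<S> \<T>)"
    then obtain xs where "xs \<in> R" "ys \<in> cell ?X \<S> {S \<in> \<S>. xs \<in> S}" by blast
    then show "ys \<in> R" using det[of xs ys] by (auto simp: cell_def)
  qed
  moreover have "finite ?I" using fin by (rule finite_subset[of _ "Pow \<S>", rotated, OF finite_Pow_iff[THEN iffD2]]) blast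
  ultimately show ?thesis using definable_UN[of ?I L M n "cell ?X \<S>"] definable_cell[OF fin def] by simp
qed

text \<open>A semantic form of Hintikka formulas. Finiteness of the language gives finitely many
  atomic tests at level 0; each further level adds the projections of the finitely many cells for
  tuples longer by one entry.\<close>

lemma back_forth_determined:
  assumes fin: "finite (dom (rel_arity L))"
  shows "\<exists>\<S>. finite \<S> \<and> (\<forall>S \<in> \<S>. definable L M l S) \<and>
    (\<forall>xs \<in> nlists l (univ M). \<forall>ys \<in> nlists l (univ M).
      (\<forall>S \<in> \<S>. xs \<in> S \<longleftrightarrow> ys \<in> S) \<longrightarrow> back_forth L M n xs ys)"
proof (induction n arbitrary: l)
  case 0
  define eqs where "eqs = (\<lambda>(i, j). {xs \<in> nlists l (univ M). xs ! i = xs ! j}) ` ({..<l} \<times> {..<l})"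
  define rels where "rels = (\<lambda>(r, js). {xs \<in> nlists l (univ M). map ((!) xs) js \<in> rel_interp M r}) `
    (SIGMA r : dom (rel_arity L). nlists (the (rel_arity L r)) {..<l})"
  have "finite (nlists m {..<l})" for m
    using finite_lists_length_eq[of "{..<l}" m] unfolding nlists_def by (simp add: conj_commute)
  then have fin_S: "finite (eqs \<union> rels)" using fin unfolding eqs_def rels_def by auto
  have def_S: "definable L M l S" if "S \<in> eqs \<union> rels" for S
    using that unfolding eqs_def rels_def by (auto intro: definable_eq definable_rel)
  have bf_S: "back_forth L M 0 xs ys"
    if xs: "xs \<in> nlists l (univ M)" and ys: "ys \<in> nlists l (univ M)"
      and ag: "\<forall>S \<in> eqs \<union> rels. xs \<in> S \<longleftrightarrow> ys \<in> S" for xs ys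
  proof -
    have "xs ! i = xs ! j \<longleftrightarrow> ys ! i = ys ! j" if "i < l" "j < l" for i j
    proof -
      have "{xs \<in> nlists l (univ M). xs ! i = xs ! j} \<in> eqs" using that unfolding eqs_def by auto
      from bspec[OF ag UnI1[OF this]] show ?thesis using xs ys by simp
    qed
    moreover have "map ((!) xs) js \<in> rel_interp M r \<longleftrightarrow> map ((!) ys) js \<in> rel_interp M r"
      if "rel_arity L r = Some m" "js \<in> nlists m {..<l}" for r m js
    proof -
      have "{xs \<in> nlists l (univ M). map ((!) xs) js \<in> rel_interp M r} \<in> rels"
        using that unfolding rels_def by (intro image_eqI[of _ _ "(r, js)"]) auto
      from bspec[OF ag UnI2[OF this]] show ?thesis using xs ys by simp
    qed
    ultimately show ?thesis using xs ys by simp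
  qed
  show ?case by (intro exI[of _ "eqs \<union> rels"] conjI ballI impI fin_S) (rule def_S bf_S; assumption)+
next
  case (Suc n)
  let ?X = "nlists l (univ M)" and ?X' = "nlists (Suc l) (univ M)"
  obtain \<S> where \<S>: "finite \<S>" "\<And>S. S \<in> \<S> \<Longrightarrow> definable L M l S"
    "\<And>xs ys. xs \<in> ?X \<Longrightarrow> ys \<in> ?X \<Longrightarrow> (\<forall>S \<in> \<S>. xs \<in> S \<longleftrightarrow> ys \<in> S) \<Longrightarrow> back_forth L M n xs ys"
    using Suc.IH[of l] by metis
  obtain \<S>' where \<S>': "finite \<S>'" "\<And>S. S \<in> \<S>' \<Longrightarrow> definable L M (Suc l) S"
    "\<And>xs ys. xs \<in> ?X' \<Longrightarrow> ys \<in> ?X' \<Longrightarrow> (\<forall>S \<in> \<S>'. xs \<in> S \<longleftrightarrow> ys \<in> S) \<Longrightarrow> back_forth L M n xs ys"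
    using Suc.IH[of "Suc l"] by metis
  \<comment> \<open>Membership in \<open>proj \<T>\<close> says that some extension by one entry has
    pattern \<T>. Tuples that agree on these sets can answer each other's new entries with the same
    pattern.\<close>
  define proj where "proj \<T> = {xs \<in> ?X. \<exists>c \<in> univ M. xs @ [c] \<in> cell ?X' \<S>' \<T>}" for \<T>
  have app: "xs @ [c] \<in> ?X'" if "xs \<in> ?X" "c \<in> univ M" for xs c
    using nlistsE_length[OF that(1)] nlistsE_set[OF that(1)] that(2) by (intro nlistsI) auto
  have forth: "\<exists>c' \<in> univ M. back_forth L M n (xs @ [c]) (ys @ [c'])"
    if xs: "xs \<in> ?X" and ys: "ys \<in> ?X" and c: "c \<in> univ M"
      and ag: "\<forall>S \<in> \<S> \<union> proj ` Pow \<S>'. xs \<in> S \<longleftrightarrow> ys \<in> S" for xs ys c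
  proof -
    define \<T> where "\<T> = {S \<in> \<S>'. xs @ [c] \<in> S}"
    have "xs @ [c] \<in> cell ?X' \<S>' \<T>" using app[OF xs c] unfolding \<T>_def cell_def by simp
    then have "xs \<in> proj \<T>" using xs c unfolding proj_def by blast
    moreover have "proj \<T> \<in> proj ` Pow \<S>'" unfolding \<T>_def by blast
    ultimately have "ys \<in> proj \<T>" using ag by blast
    then obtain c' where c': "c' \<in> univ M" "ys @ [c'] \<in> cell ?X' \<S>' \<T>" unfolding proj_def by blast
    then have "\<forall>S \<in> \<S>'. xs @ [c] \<in> S \<longleftrightarrow> ys @ [c'] \<in> S" unfolding cell_def \<T>_def by blast
    then have "back_forth L M n (xs @ [c]) (ys @ [c'])"
      by (rule \<S>'(3)[OF app[OF xs c] app[OF ys c'(1)]])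
    then show ?thesis using c'(1) by blast
  qed
  have fin_S: "finite (\<S> \<union> proj ` Pow \<S>')" using \<S>(1) \<S>'(1) by simp
  have def_S: "definable L M l S" if "S \<in> \<S> \<union> proj ` Pow \<S>'" for S
    using that \<S>(2) definable_projection[OF definable_cell[OF \<S>'(1,2)]] unfolding proj_def by blast
  have bf_S: "back_forth L M (Suc n) xs ys"
    if xs: "xs \<in> ?X" and ys: "ys \<in> ?X" and ag: "\<forall>S \<in> \<S> \<union> proj ` Pow \<S>'. xs \<in> S \<longleftrightarrow> ys \<in> S" for xs ys
  proof -
    have "back_forth L M n xs ys" using \<S>(3)[OF xs ys] ag by blast
    moreover have "\<exists>c' \<in> univ M. back_forth L M n (xs @ [c]) (ys @ [c'])" if "c \<in> univ M" for c
      by (rule forth[OF xs ys that ag])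
    moreover have "\<exists>c' \<in> univ M. back_forth L M n (xs @ [c']) (ys @ [c])" if "c \<in> univ M" for c
    proof -
      have "\<forall>S \<in> \<S> \<union> proj ` Pow \<S>'. ys \<in> S \<longleftrightarrow> xs \<in> S" using ag by blast
      from forth[OF ys xs that this] show ?thesis using back_forth_sym by blast
    qed
    ultimately show ?thesis unfolding back_forth.simps by (intro conjI ballI)
  qed
  show ?case
    by (intro exI[of _ "\<S> \<union> proj ` Pow \<S>'"] conjI ballI impI fin_S) (rule def_S bf_S; assumption)+
qed

section \<open>Ultrapowers of structures\<close>

text \<open>Zorn's lemma for proper filters below F, finer ones counting as larger. The infimum of a
  chain is proper because whatever holds eventually for it does so for a member. A maximal U decides
  every P: if the negation of P is not in U, adjoining P leaves U proper and hence
  unchanged.\<close>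

lemma ultrafilter_exists:
  assumes "F \<noteq> (bot :: 'i filter)"
  obtains U where "U \<le> F" "ultrafilter U"
proof -
  let ?A = "{G. G \<noteq> bot \<and> G \<le> F}"
  define r where "r = {(G, H). G \<in> ?A \<and> H \<in> ?A \<and> H \<le> G}"
  have Field: "Field r = ?A" unfolding r_def Field_def by auto
  have po: "Partial_order r"
    unfolding partial_order_on_def preorder_on_def Field
    by (auto simp: r_def refl_on_def trans_def antisym_def)
  have "\<exists>m \<in> Field r. \<forall>a \<in> Field r. (m, a) \<in> r \<longrightarrow> a = m"
  proof (rule Zorns_po_lemma[OF po])
    fix C assume C: "C \<in> Chains r"
    show "\<exists>u \<in> Field r. \<forall>a \<in> C. (a, u) \<in> r"
    proof (cases "C = {}")
      case True
      then show ?thesis using assms unfolding Field by auto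
    next
      case False
      have sub: "C \<subseteq> ?A" using C unfolding Chains_def r_def by blast
      have "eventually P (Inf C) \<longleftrightarrow> (\<exists>G \<in> C. eventually P G)" for P
      proof (rule eventually_Inf_base[OF False])
        fix G H assume "G \<in> C" "H \<in> C"
        then have "G \<le> H \<or> H \<le> G" using C unfolding Chains_def r_def by blast
        then show "\<exists>K \<in> C. K \<le> inf G H" using \<open>G \<in> C\<close> \<open>H \<in> C\<close> by auto
      qed
      then have "Inf C \<noteq> bot" using sub unfolding trivial_limit_def by blast
      moreover have "Inf C \<le> F" using False sub by (auto intro: Inf_lower2)
      ultimately have "Inf C \<in> ?A" by blast
      then show ?thesis unfolding Field using sub by (auto simp: r_def intro!: bexI[of _ "Inf C"] Inf_lower)
    qed
  qed
  then obtain U where U: "U \<in> ?A" and m: "\<forall>G \<in> ?A. (U, G) \<in> r \<longrightarrow> G = U"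
    unfolding Field by (rule bexE)
  have max: "G = U" if "G \<noteq> bot" "G \<le> U" for G
  proof -
    have "G \<in> ?A" using that U by auto
    then show ?thesis using m U that unfolding r_def by simp
  qed
  have "eventually P U \<or> eventually (\<lambda>i. \<not> P i) U" for P
  proof (rule disjCI)
    assume "\<not> eventually (\<lambda>i. \<not> P i) U"
    then have "inf U (principal {i. P i}) \<noteq> bot"
      by (simp add: trivial_limit_def eventually_inf_principal)
    then have "inf U (principal {i. P i}) = U" by (rule max) simp
    moreover have "eventually P (inf U (principal {i. P i}))" by (simp add: eventually_inf_principal)
    ultimately show "eventually P U" by simp
  qed
  then show thesis using that U unfolding ultrafilter_def by blast
qed

lemma ultrafilter_eventually_not:
  assumes "ultrafilter U"
  shows "eventually (\<lambda>i. \<not> P i) U \<longleftrightarrow> \<not> eventually P U"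
proof
  assume not_P: "eventually (\<lambda>i. \<not> P i) U"
  show "\<not> eventually P U"
  proof
    assume "eventually P U"
    with not_P have "eventually (\<lambda>i. False) U" by eventually_elim simp
    then show False using assms unfolding ultrafilter_def by (simp add: eventually_False)
  qed
next
  show "\<not> eventually P U \<Longrightarrow> eventually (\<lambda>i. \<not> P i) U"
    using assms unfolding ultrafilter_def by blast
qed

section \<open>The theorem of Los and its form for relations on powers\<close>

locale ultrapower_of =
  fixes L :: "('f, 'r) lang" and M :: "('f, 'r, 'a) struct" and U :: "'i filter"
  assumes M: "is_structure L M" and U: "ultrafilter U"
begin

abbreviation "N \<equiv> ultrapower M U"

definition cls :: "('i \<Rightarrow> 'a) \<Rightarrow> ('i \<Rightarrow> 'a) set" where
  "cls s = ultra_eq M U `` {s}"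

lemma U_not: "eventually (\<lambda>i. \<not> P i) U \<longleftrightarrow> \<not> eventually P U"
  using ultrafilter_eventually_not[OF U] .

lemma equiv_ultra_eq: "equiv {s. range s \<subseteq> univ M} (ultra_eq M U)"
proof (rule equivI)
  show "ultra_eq M U \<subseteq> {s. range s \<subseteq> univ M} \<times> {s. range s \<subseteq> univ M}"
    unfolding ultra_eq_def by blast
  show "refl_on {s. range s \<subseteq> univ M} (ultra_eq M U)"
    unfolding ultra_eq_def refl_on_def by auto
  show "sym (ultra_eq M U)"
    unfolding ultra_eq_def by (auto intro!: symI elim: eventually_mono)
  show "trans (ultra_eq M U)"
    unfolding ultra_eq_def by (auto intro!: transI elim: eventually_elim2)
qed

lemma cls_eq_iff:
  "range s \<subseteq> univ M \<Longrightarrow> range t \<subseteq> univ M \<Longrightarrow> cls s = cls t \<longleftrightarrow> eventually (\<lambda>i. s i = t i) U"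
  unfolding cls_def using eq_equiv_class_iff[OF equiv_ultra_eq, of s t] by (simp add: ultra_eq_def)

lemma univ_N: "univ N = cls ` {s. range s \<subseteq> univ M}"
  unfolding ultrapower_def cls_def quotient_def by auto

lemma mem_cls_iff: "t \<in> cls s \<longleftrightarrow> range s \<subseteq> univ M \<and> range t \<subseteq> univ M \<and> eventually (\<lambda>i. s i = t i) U"
  unfolding cls_def ultra_eq_def by auto

lemma list_all2_mem_cls:
  "list_all2 (\<in>) ts (map cls ss) \<Longrightarrow>
    list_all (\<lambda>t. range t \<subseteq> univ M) ts \<and> eventually (\<lambda>i. map (\<lambda>s. s i) ss = map (\<lambda>t. t i) ts) U"
proof (induction ss arbitrary: ts)
  case (Cons s ss)
  then obtain t ts' where ts: "ts = t # ts'" "t \<in> cls s" "list_all2 (\<in>) ts' (map cls ss)"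
    by (auto simp: list_all2_Cons2)
  then show ?case using Cons.IH[OF ts(3)] by (auto simp: mem_cls_iff elim: eventually_elim2)
qed simp

lemma list_all2_cls: "list_all (\<lambda>s. range s \<subseteq> univ M) ss \<Longrightarrow> list_all2 (\<in>) ss (map cls ss)"
  by (induction ss) (auto simp: mem_cls_iff)

lemma fn_closed:
  assumes "fn_arity L f = Some (length ss)" "list_all (\<lambda>s. range s \<subseteq> univ M) ss"
  shows "fn_interp M f (map (\<lambda>s. s i) ss) \<in> univ M"
proof -
  have "map (\<lambda>s. s i) ss \<in> nlists (length ss) (univ M)"
    using assms(2) by (intro nlistsI) (auto simp: list_all_iff)
  then show ?thesis using M assms(1) unfolding is_structure_def by blast
qed

lemma fn_interp_N:
  assumes f: "fn_arity L f = Some (length ss)" and ss: "list_all (\<lambda>s. range s \<subseteq> univ M) ss"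
  shows "fn_interp N f (map cls ss) = cls (\<lambda>i. fn_interp M f (map (\<lambda>s. s i) ss))"
proof -
  have "cls (\<lambda>i. fn_interp M f (map (\<lambda>s. s i) ts)) = cls (\<lambda>i. fn_interp M f (map (\<lambda>s. s i) ss))"
    if ts: "list_all2 (\<in>) ts (map cls ss)" for ts
  proof -
    have len: "length ts = length ss" using list_all2_lengthD[OF ts] by simp
    show ?thesis
    proof (subst cls_eq_iff)
      show "range (\<lambda>i. fn_interp M f (map (\<lambda>s. s i) ts)) \<subseteq> univ M"
        using f len list_all2_mem_cls[OF ts] fn_closed[of f ts] by auto
      show "range (\<lambda>i. fn_interp M f (map (\<lambda>s. s i) ss)) \<subseteq> univ M"
        using fn_closed[OF f ss] by auto
      show "\<forall>\<^sub>F i in U. fn_interp M f (map (\<lambda>s. s i) ts) = fn_interp M f (map (\<lambda>s. s i) ss)"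
        using list_all2_mem_cls[OF ts] by (auto elim: eventually_mono)
    qed
  qed
  moreover have "list_all2 (\<in>) ss (map cls ss)" using list_all2_cls[OF ss] .
  moreover have "fn_interp N f (map cls ss) =
      (\<Union>ts \<in> {ts. list_all2 (\<in>) ts (map cls ss)}. cls (\<lambda>i. fn_interp M f (map (\<lambda>s. s i) ts)))"
    unfolding ultrapower_def cls_def by simp
  ultimately show ?thesis by blast
qed

lemma rel_interp_N:
  assumes ss: "list_all (\<lambda>s. range s \<subseteq> univ M) ss"
  shows "map cls ss \<in> rel_interp N r \<longleftrightarrow> eventually (\<lambda>i. map (\<lambda>s. s i) ss \<in> rel_interp M r) U"
proof -
  have "map cls ss \<in> lists (univ N)" using ss unfolding univ_N by (auto simp: list_all_iff)
  then have "map cls ss \<in> rel_interp N r \<longleftrightarrow> (\<exists>ts. list_all2 (\<in>) ts (map cls ss) \<and>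
      eventually (\<lambda>i. map (\<lambda>s. s i) ts \<in> rel_interp M r) U)"
    unfolding ultrapower_def by simp
  also have "\<dots> \<longleftrightarrow> eventually (\<lambda>i. map (\<lambda>s. s i) ss \<in> rel_interp M r) U"
  proof
    assume "\<exists>ts. list_all2 (\<in>) ts (map cls ss) \<and> eventually (\<lambda>i. map (\<lambda>s. s i) ts \<in> rel_interp M r) U"
    then obtain ts where ts: "list_all2 (\<in>) ts (map cls ss)"
      and ev: "eventually (\<lambda>i. map (\<lambda>s. s i) ts \<in> rel_interp M r) U" by blast
    have "eventually (\<lambda>i. map (\<lambda>s. s i) ss = map (\<lambda>t. t i) ts) U" using list_all2_mem_cls[OF ts] by blast
    then show "eventually (\<lambda>i. map (\<lambda>s. s i) ss \<in> rel_interp M r) U"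
      using ev by eventually_elim simp
  next
    assume "eventually (\<lambda>i. map (\<lambda>s. s i) ss \<in> rel_interp M r) U"
    then show "\<exists>ts. list_all2 (\<in>) ts (map cls ss) \<and> eventually (\<lambda>i. map (\<lambda>s. s i) ts \<in> rel_interp M r) U"
      using list_all2_cls[OF ss] by blast
  qed
  finally show ?thesis .
qed

lemma lists_univ_N: "set Xs \<subseteq> univ N \<Longrightarrow> \<exists>ss. list_all (\<lambda>s. range s \<subseteq> univ M) ss \<and> Xs = map cls ss"
proof (induction Xs)
  case Nil
  then show ?case by simp
next
  case (Cons X Xs)
  then obtain s ss where "range s \<subseteq> univ M" "X = cls s" "list_all (\<lambda>s. range s \<subseteq> univ M) ss" "Xs = map cls ss"
    unfolding univ_N by auto
  then show ?case by (intro exI[of _ "s # ss"]) simp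
qed

lemma is_structure_N: "is_structure L N"
  unfolding is_structure_def
proof (intro conjI allI impI ballI subsetI)
  obtain c where "c \<in> univ M" using M unfolding is_structure_def by blast
  then have "cls (\<lambda>_. c) \<in> univ N" unfolding univ_N by (intro imageI) auto
  then show "univ N \<noteq> {}" by blast
next
  fix f n Xs assume f: "fn_arity L f = Some n" and Xs: "Xs \<in> nlists n (univ N)"
  obtain ss where ss: "list_all (\<lambda>s. range s \<subseteq> univ M) ss" "Xs = map cls ss"
    using lists_univ_N[OF nlistsE_set[OF Xs]] by blast
  have f': "fn_arity L f = Some (length ss)" using f nlistsE_length[OF Xs] ss(2) by simp
  show "fn_interp N f Xs \<in> univ N"
    unfolding ss(2) fn_interp_N[OF f' ss(1)] univ_N using fn_closed[OF f' ss(1)] by blast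
next
  fix r n Xs assume r: "rel_arity L r = Some n" and Xs: "Xs \<in> rel_interp N r"
  have "Xs \<in> lists (univ N)" using Xs unfolding ultrapower_def by simp
  then have sub: "set Xs \<subseteq> univ N" by auto
  obtain ss where ss: "list_all (\<lambda>s. range s \<subseteq> univ M) ss" "Xs = map cls ss"
    using lists_univ_N[OF sub] by blast
  have "eventually (\<lambda>i. map (\<lambda>s. s i) ss \<in> rel_interp M r) U"
    using Xs unfolding ss(2) rel_interp_N[OF ss(1)] .
  then obtain i where "map (\<lambda>s. s i) ss \<in> rel_interp M r"
    using U eventually_happens unfolding ultrafilter_def by blast
  then have "map (\<lambda>s. s i) ss \<in> nlists n (univ M)" using M r unfolding is_structure_def by blast
  then have "length ss = n" using nlistsE_length by fastforce
  then show "Xs \<in> nlists n (univ N)" using sub ss(2) by (intro nlistsI) auto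
qed

lemma eval_trm_N:
  assumes v: "\<And>n. range (v n) \<subseteq> univ M" and "wf_trm L t"
  shows "eval_trm N (\<lambda>n. cls (v n)) t = cls (\<lambda>i. eval_trm M (\<lambda>n. v n i) t)"
  using assms(2)
proof (induction t)
  case (Fn f ts)
  define ss where "ss = map (\<lambda>t i. eval_trm M (\<lambda>n. v n i) t) ts"
  have "range (\<lambda>n. v n i) \<subseteq> univ M" for i using v by blast
  then have ss: "list_all (\<lambda>s. range s \<subseteq> univ M) ss"
    using Fn.prems eval_trm_closed[OF M] unfolding ss_def by (auto simp: list_all_iff)
  have "map (eval_trm N (\<lambda>n. cls (v n))) ts = map cls ss"
    unfolding ss_def using Fn.prems by (auto simp: list_all_iff Fn.IH)
  then have "eval_trm N (\<lambda>n. cls (v n)) (Fn f ts) = fn_interp N f (map cls ss)" by simp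
  also have "\<dots> = cls (\<lambda>i. fn_interp M f (map (\<lambda>s. s i) ss))"
    by (rule fn_interp_N) (use Fn.prems ss in \<open>simp_all add: ss_def\<close>)
  also have "\<dots> = cls (\<lambda>i. eval_trm M (\<lambda>n. v n i) (Fn f ts))"
    unfolding ss_def by (simp add: comp_def)
  finally show ?case .
qed simp

theorem los:
  assumes "\<And>n. range (v n) \<subseteq> univ M" and "wf_fm L \<phi>"
  shows "sat N (\<lambda>n. cls (v n)) \<phi> \<longleftrightarrow> eventually (\<lambda>i. sat M (\<lambda>n. v n i) \<phi>) U"
  using assms
proof (induction \<phi> arbitrary: v)
  case (Eq s t)
  have v: "range (\<lambda>n. v n i) \<subseteq> univ M" for i using Eq.prems(1) by blast
  have "range (\<lambda>i. eval_trm M (\<lambda>n. v n i) s) \<subseteq> univ M" "range (\<lambda>i. eval_trm M (\<lambda>n. v n i) t) \<subseteq> univ M"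
    using Eq.prems(2) eval_trm_closed[OF M v] by auto
  then show ?case using Eq.prems by (simp add: eval_trm_N cls_eq_iff)
next
  case (Rel r ts)
  define ss where "ss = map (\<lambda>t i. eval_trm M (\<lambda>n. v n i) t) ts"
  have "range (\<lambda>n. v n i) \<subseteq> univ M" for i using Rel.prems(1) by blast
  then have ss: "list_all (\<lambda>s. range s \<subseteq> univ M) ss"
    using Rel.prems eval_trm_closed[OF M] unfolding ss_def by (auto simp: list_all_iff)
  have "map (eval_trm N (\<lambda>n. cls (v n))) ts = map cls ss"
    unfolding ss_def using Rel.prems by (auto simp: list_all_iff eval_trm_N)
  then have "sat N (\<lambda>n. cls (v n)) (Rel r ts) \<longleftrightarrow> map cls ss \<in> rel_interp N r" by simp
  also have "\<dots> \<longleftrightarrow> eventually (\<lambda>i. map (\<lambda>s. s i) ss \<in> rel_interp M r) U" by (rule rel_interp_N[OF ss])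
  also have "\<dots> \<longleftrightarrow> eventually (\<lambda>i. sat M (\<lambda>n. v n i) (Rel r ts)) U"
    unfolding ss_def by (simp add: comp_def)
  finally show ?case .
next
  case (Neg \<phi>)
  have "sat N (\<lambda>n. cls (v n)) \<phi> \<longleftrightarrow> eventually (\<lambda>i. sat M (\<lambda>n. v n i) \<phi>) U"
    by (rule Neg.IH) (use Neg.prems in auto)
  then show ?case by (simp add: U_not)
next
  case (Conj \<phi> \<psi>)
  have "sat N (\<lambda>n. cls (v n)) \<phi> \<longleftrightarrow> eventually (\<lambda>i. sat M (\<lambda>n. v n i) \<phi>) U"
    by (rule Conj.IH(1)) (use Conj.prems in auto)
  moreover have "sat N (\<lambda>n. cls (v n)) \<psi> \<longleftrightarrow> eventually (\<lambda>i. sat M (\<lambda>n. v n i) \<psi>) U"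
    by (rule Conj.IH(2)) (use Conj.prems in auto)
  ultimately show ?case by (simp add: eventually_conj_iff)
next
  case (Exists k \<phi>)
  have upd: "(\<lambda>n. cls (v n))(k := cls s) = (\<lambda>n. cls ((v(k := s)) n))" for s by (rule ext) simp
  have upd': "(\<lambda>n. (v(k := s)) n i) = (\<lambda>n. v n i)(k := s i)" for s i by (rule ext) simp
  have step: "sat N ((\<lambda>n. cls (v n))(k := cls s)) \<phi> \<longleftrightarrow> eventually (\<lambda>i. sat M ((\<lambda>n. v n i)(k := s i)) \<phi>) U"
    if "range s \<subseteq> univ M" for s
  proof -
    have "sat N (\<lambda>n. cls ((v(k := s)) n)) \<phi> \<longleftrightarrow> eventually (\<lambda>i. sat M (\<lambda>n. (v(k := s)) n i) \<phi>) U"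
      by (rule Exists.IH) (use Exists.prems that in auto)
    then show ?thesis unfolding upd upd' .
  qed
  show ?case
  proof
    assume "sat N (\<lambda>n. cls (v n)) (Exists k \<phi>)"
    then obtain s where s: "range s \<subseteq> univ M" "sat N ((\<lambda>n. cls (v n))(k := cls s)) \<phi>"
      unfolding sat.simps univ_N by blast
    then have "eventually (\<lambda>i. sat M ((\<lambda>n. v n i)(k := s i)) \<phi>) U" using step by blast
    then show "eventually (\<lambda>i. sat M (\<lambda>n. v n i) (Exists k \<phi>)) U"
      by eventually_elim (use s(1) in auto)
  next
    assume ev: "eventually (\<lambda>i. sat M (\<lambda>n. v n i) (Exists k \<phi>)) U"
    obtain c where c: "c \<in> univ M" using M unfolding is_structure_def by blast
    \<comment> \<open>A witness function chosen index by index; the value c at the remaining indices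
      does not affect its class, since witnesses exist almost everywhere.\<close>
    define s where "s i = (if \<exists>a \<in> univ M. sat M ((\<lambda>n. v n i)(k := a)) \<phi>
      then SOME a. a \<in> univ M \<and> sat M ((\<lambda>n. v n i)(k := a)) \<phi> else c)" for i
    have s: "s i \<in> univ M \<and> sat M ((\<lambda>n. v n i)(k := s i)) \<phi>"
      if "\<exists>a \<in> univ M. sat M ((\<lambda>n. v n i)(k := a)) \<phi>" for i
    proof -
      have "\<exists>a. a \<in> univ M \<and> sat M ((\<lambda>n. v n i)(k := a)) \<phi>" using that by blast
      from someI_ex[OF this] show ?thesis using that unfolding s_def by simp
    qed
    have "s i \<in> univ M" for i using s[of i] c unfolding s_def by presburger
    then have rs: "range s \<subseteq> univ M" by blast
    have "eventually (\<lambda>i. sat M ((\<lambda>n. v n i)(k := s i)) \<phi>) U"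
      using ev by eventually_elim (use s in auto)
    then have "sat N ((\<lambda>n. cls (v n))(k := cls s)) \<phi>" using step[OF rs] by blast
    then show "sat N (\<lambda>n. cls (v n)) (Exists k \<phi>)" using rs unfolding sat.simps univ_N by blast
  qed
qed

lemma los_nth:
  assumes ss: "list_all (\<lambda>s. range s \<subseteq> univ M) ss" and \<phi>: "formula_in L (length ss) \<phi>"
  shows "sat N ((!) (map cls ss)) \<phi> \<longleftrightarrow> eventually (\<lambda>i. sat M ((!) (map (\<lambda>s. s i) ss)) \<phi>) U"
proof -
  obtain c where c: "c \<in> univ M" using M unfolding is_structure_def by blast
  \<comment> \<open>\<open>los\<close> speaks of valuations of all variables by functions into the
    universe; the constant function c pads the list.\<close>
  define v where "v n = (if n < length ss then ss ! n else (\<lambda>_. c))" for n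
  have v: "range (v n) \<subseteq> univ M" for n using ss c by (auto simp: v_def list_all_length)
  have fv: "n < length ss" if "n \<in> fv_fm \<phi>" for n using \<phi> that unfolding formula_in_def by auto
  have "sat N ((!) (map cls ss)) \<phi> \<longleftrightarrow> sat N (\<lambda>n. cls (v n)) \<phi>"
    by (rule sat_cong) (simp add: fv v_def)
  also have "\<dots> \<longleftrightarrow> eventually (\<lambda>i. sat M (\<lambda>n. v n i) \<phi>) U"
    using \<phi> unfolding formula_in_def by (intro los v) blast
  also have "(\<lambda>i. sat M (\<lambda>n. v n i) \<phi>) = (\<lambda>i. sat M ((!) (map (\<lambda>s. s i) ss)) \<phi>)"
    by (rule ext, rule sat_cong) (simp add: fv v_def)
  finally show ?thesis .
qed

lemma los_extension:
  assumes ss: "list_all (\<lambda>s. range s \<subseteq> univ M) ss" "length ss = n" and \<phi>: "formula_in L n \<phi>"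
  shows "map cls ss \<in> extension N n \<phi> \<longleftrightarrow> eventually (\<lambda>i. map (\<lambda>s. s i) ss \<in> extension M n \<phi>) U"
proof -
  have "map cls ss \<in> nlists n (univ N)" using ss unfolding univ_N by (intro nlistsI) (auto simp: list_all_iff)
  moreover have "map (\<lambda>s. s i) ss \<in> nlists n (univ M)" for i
    using ss by (intro nlistsI) (auto simp: list_all_iff)
  ultimately show ?thesis using los_nth[OF ss(1)] \<phi> ss(2) unfolding extension_def by simp
qed

text \<open>The identification of the ultrapower of M^d with the d-th power of the ultrapower of M.
  The coupling lives on functions into M^d, the automorphism on d-tuples of classes.\<close>

definition pcls :: "nat \<Rightarrow> ('i \<Rightarrow> 'a list) \<Rightarrow> ('i \<Rightarrow> 'a) set list" where
  "pcls d a = map (\<lambda>j. cls (\<lambda>i. a i ! j)) [0..<d]"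

lemma range_nth:
  assumes "range a \<subseteq> nlists d (univ M)" "j < d"
  shows "range (\<lambda>i. a i ! j) \<subseteq> univ M"
  using assms by (auto intro: nlistsE_nth_in)

lemma pcls_image: "pcls d ` {a. range a \<subseteq> nlists d (univ M)} = nlists d (univ N)"
proof (intro equalityI subsetI)
  fix x assume "x \<in> pcls d ` {a. range a \<subseteq> nlists d (univ M)}"
  then obtain a where a: "x = pcls d a" "range a \<subseteq> nlists d (univ M)" by blast
  have "cls (\<lambda>i. a i ! j) \<in> univ N" if "j < d" for j
    unfolding univ_N using range_nth[OF a(2) that] by blast
  then show "x \<in> nlists d (univ N)" unfolding a(1) pcls_def by (intro nlistsI) auto
next
  fix x assume x: "x \<in> nlists d (univ N)"
  obtain ss where ss: "list_all (\<lambda>s. range s \<subseteq> univ M) ss" "x = map cls ss"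
    using lists_univ_N[OF nlistsE_set[OF x]] by blast
  have len: "length ss = d" using nlistsE_length[OF x] ss(2) by simp
  define a where "a i = map (\<lambda>s. s i) ss" for i
  have "a i \<in> nlists d (univ M)" for i
    using ss(1) len unfolding a_def list_all_iff by (intro nlistsI) auto
  then have "range a \<subseteq> nlists d (univ M)" by blast
  moreover have "x = pcls d a"
    using len unfolding pcls_def a_def ss(2) by (intro nth_equalityI) auto
  ultimately show "x \<in> pcls d ` {a. range a \<subseteq> nlists d (univ M)}" by blast
qed

lemma pcls_mem: "range a \<subseteq> nlists d (univ M) \<Longrightarrow> pcls d a \<in> nlists d (univ N)"
  using pcls_image by blast

lemma pcls_eq_iff:
  assumes a: "range a \<subseteq> nlists d (univ M)" and b: "range b \<subseteq> nlists d (univ M)"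
  shows "pcls d a = pcls d b \<longleftrightarrow> eventually (\<lambda>i. a i = b i) U"
proof -
  have "pcls d a = pcls d b \<longleftrightarrow> (\<forall>j \<in> {..<d}. eventually (\<lambda>i. a i ! j = b i ! j) U)"
    using cls_eq_iff[OF range_nth[OF a] range_nth[OF b]] unfolding pcls_def by auto
  also have "\<dots> \<longleftrightarrow> eventually (\<lambda>i. \<forall>j \<in> {..<d}. a i ! j = b i ! j) U"
    by (simp add: eventually_ball_finite_distrib)
  also have "(\<lambda>i. \<forall>j \<in> {..<d}. a i ! j = b i ! j) = (\<lambda>i. a i = b i)"
  proof
    fix i
    have "length (a i) = d" "length (b i) = d"
      using nlistsE_length[of "a i" d] nlistsE_length[of "b i" d] a b by blast+
    then show "(\<forall>j \<in> {..<d}. a i ! j = b i ! j) \<longleftrightarrow> a i = b i" by (auto simp: list_eq_iff_nth_eq)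
  qed
  finally show ?thesis .
qed

text \<open>Flattens functions into M^d to functions into M in the order of \<open>concat\<close>,
  so that it commutes both with taking classes and with evaluating at an index.\<close>

definition coords :: "nat \<Rightarrow> ('i \<Rightarrow> 'a list) list \<Rightarrow> ('i \<Rightarrow> 'a) list" where
  "coords d as = concat (map (\<lambda>a. map (\<lambda>j i. a i ! j) [0..<d]) as)"

lemma concat_pcls: "concat (map (pcls d) as) = map cls (coords d as)"
  unfolding coords_def pcls_def by (simp add: map_concat comp_def)

lemma coords_at:
  assumes "list_all (\<lambda>a. range a \<subseteq> nlists d (univ M)) as"
  shows "map (\<lambda>s. s i) (coords d as) = concat (map (\<lambda>a. a i) as)"
proof -
  have "map (\<lambda>j. a i ! j) [0..<d] = a i" if "a \<in> set as" for a
  proof -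
    have "a i \<in> nlists d (univ M)" using assms that unfolding list_all_iff by blast
    then show ?thesis using map_nth[of "a i"] by simp
  qed
  then have "map (\<lambda>a. map (\<lambda>j. a i ! j) [0..<d]) as = map (\<lambda>a. a i) as" by simp
  moreover have "map (\<lambda>s. s i) (coords d as) = concat (map (\<lambda>a. map (\<lambda>j. a i ! j) [0..<d]) as)"
    unfolding coords_def by (simp add: map_concat comp_def)
  ultimately show ?thesis by (simp only:)
qed

lemma coords_range:
  assumes "list_all (\<lambda>a. range a \<subseteq> nlists d (univ M)) as"
  shows "list_all (\<lambda>s. range s \<subseteq> univ M) (coords d as)"
proof -
  have "range (\<lambda>i. a i ! j) \<subseteq> univ M" if "a \<in> set as" "j < d" for a j
    using assms that by (intro range_nth) (auto simp: list_all_iff)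
  then show ?thesis unfolding coords_def list_all_iff by auto
qed

lemma length_coords: "length (coords d as) = d * length as"
  unfolding coords_def by (induction as) auto

lemma los_power_extension:
  assumes as: "list_all (\<lambda>a. range a \<subseteq> nlists d (univ M)) as" "length as = n"
    and \<phi>: "formula_in L (d * n) \<phi>"
  shows "map (pcls d) as \<in> power_extension N d n \<phi> \<longleftrightarrow>
    eventually (\<lambda>i. map (\<lambda>a. a i) as \<in> power_extension M d n \<phi>) U"
proof -
  have 1: "map (pcls d) as \<in> nlists n (nlists d (univ N))"
    using as pcls_mem by (intro nlistsI) (auto simp: list_all_iff)
  have 2: "map (\<lambda>a. a i) as \<in> nlists n (nlists d (univ M))" for i
    using as by (intro nlistsI) (auto simp: list_all_iff)
  have "concat (map (pcls d) as) \<in> extension N (d * n) \<phi> \<longleftrightarrow>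
      eventually (\<lambda>i. concat (map (\<lambda>a. a i) as) \<in> extension M (d * n) \<phi>) U"
    unfolding concat_pcls coords_at[OF as(1), symmetric]
    by (rule los_extension[OF coords_range[OF as(1)] _ \<phi>]) (simp add: length_coords as(2))
  then show ?thesis using 1 2 unfolding power_extension_def by simp
qed

lemma nlists_pcls:
  assumes "xs \<in> nlists n (nlists d (univ N))"
  obtains as where "list_all (\<lambda>a. range a \<subseteq> nlists d (univ M)) as" "length as = n" "xs = map (pcls d) as"
proof -
  have "xs \<in> lists (pcls d ` {a. range a \<subseteq> nlists d (univ M)})"
    unfolding pcls_image using nlistsE_set[OF assms] by auto
  then obtain as where "as \<in> lists {a. range a \<subseteq> nlists d (univ M)}" "xs = map (pcls d) as"
    unfolding lists_image by blast
  then show thesis using nlistsE_length[OF assms] by (intro that[of as]) (auto simp: list_all_iff)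
qed

end

section \<open>Coded symmetry groups\<close>

text \<open>The defining formula is invariant in both directions, and the inverse of \<sigma>
  supplies preimages, which turns inclusion into equality. Applied to coded maps this gives the
  direction from definability in \<P> to preservation by H.\<close>

lemma automorphism_image_definable:
  assumes "is_structure L M" "automorphism L M \<sigma>" "definable L M n R"
  shows "map \<sigma> ` R = R"
proof -
  obtain \<phi> where \<phi>: "formula_in L n \<phi>" "R = extension M n \<phi>"
    using assms(3) unfolding definable_def by blast
  have sub: "R \<subseteq> nlists n (univ M)" by (rule definable_subset[OF assms(3)])
  have bij: "bij_betw \<sigma> (univ M) (univ M)" using assms(2) unfolding automorphism_def by blast
  have iff: "map \<sigma> xs \<in> R \<longleftrightarrow> xs \<in> R" if "xs \<in> nlists n (univ M)" for xs
    unfolding \<phi>(2) by (rule extension_automorphism[OF assms(1,2) \<phi>(1) that])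
  show ?thesis
  proof (intro equalityI subsetI)
    fix ys assume "ys \<in> map \<sigma> ` R"
    then show "ys \<in> R" using iff sub by blast
  next
    fix ys assume ys: "ys \<in> R"
    then have ys': "set ys \<subseteq> univ M" "length ys = n"
      using nlistsE_set[of ys n "univ M"] nlistsE_length[of ys n "univ M"] sub by blast+
    define xs where "xs = map (inv_into (univ M) \<sigma>) ys"
    have "map \<sigma> xs = ys"
      unfolding xs_def using ys'(1) bij_betw_inv_into_right[OF bij] by (auto intro!: map_idI)
    moreover have "xs \<in> nlists n (univ M)"
      unfolding xs_def using ys' bij_betwE[OF bij_betw_inv_into[OF bij]] by (intro nlistsI) auto
    ultimately show "ys \<in> map \<sigma> ` R" using iff ys by (metis imageI)
  qed
qed

lemma
  assumes "coded_symmetry_group L M d k ar Q m D \<theta>" and "h \<in> admissible_codes M m D"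
  shows coded_map_bij: "bij_betw (coded_map M d \<theta> h) (nlists d (univ M)) (nlists d (univ M))"
    and code_graph_iff: "x \<in> nlists d (univ M) \<Longrightarrow> y \<in> nlists d (univ M) \<Longrightarrow>
      code_graph M \<theta> h x y \<longleftrightarrow> y = coded_map M d \<theta> h x"
proof -
  obtain g where g: "bij_betw g (nlists d (univ M)) (nlists d (univ M))"
    "\<forall>x \<in> nlists d (univ M). \<forall>y \<in> nlists d (univ M). code_graph M \<theta> h x y \<longleftrightarrow> y = g x"
    using assms unfolding coded_symmetry_group_def Let_def by blast
  have eq: "coded_map M d \<theta> h x = g x" if "x \<in> nlists d (univ M)" for x
    unfolding coded_map_def using g that bij_betwE[OF g(1)] by (intro the_equality) auto
  show "bij_betw (coded_map M d \<theta> h) (nlists d (univ M)) (nlists d (univ M))"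
    using g(1) eq bij_betw_cong by blast
  show "code_graph M \<theta> h x y \<longleftrightarrow> y = coded_map M d \<theta> h x"
    if "x \<in> nlists d (univ M)" "y \<in> nlists d (univ M)"
    using g(2) eq that by simp
qed

lemma is_structure_power_struct:
  assumes "univ M \<noteq> {}" "\<And>i. i < k \<Longrightarrow> Q i \<subseteq> nlists (ar i) (nlists d (univ M))"
  shows "is_structure (rel_lang k ar) (power_struct M d Q)"
proof -
  have "nlists d (univ M) \<noteq> {}" using nlists_not_empty[OF assms(1), of d] by blast
  then show ?thesis
    using assms(2) unfolding is_structure_def rel_lang_def power_struct_def by (simp split: if_splits)
qed

lemma coded_map_automorphism:
  assumes "coded_symmetry_group L M d k ar Q m D \<theta>" and "h \<in> admissible_codes M m D"
  shows "automorphism (rel_lang k ar) (power_struct M d Q) (coded_map M d \<theta> h)"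
proof -
  have "\<forall>i < k. \<forall>xs \<in> nlists (ar i) (nlists d (univ M)). xs \<in> Q i \<longleftrightarrow> map (coded_map M d \<theta> h) xs \<in> Q i"
    using assms unfolding coded_symmetry_group_def Let_def by blast
  then show ?thesis
    using coded_map_bij[OF assms] unfolding automorphism_def rel_lang_def power_struct_def by (simp split: if_splits)
qed

text \<open>A coded map of the ultrapower is an ultraproduct of coded maps of M: by Los,
  representatives of the code are admissible at almost all indices, and the formula \<theta> is
  evaluated index by index. That y is unique in the ultrapower comes out of the same
  equivalence.\<close>

lemma (in ultrapower_of) coded_map_N:
  assumes H: "coded_symmetry_group L M d k ar Q m D \<theta>" and c: "c \<in> admissible_codes N m D"
  obtains g where "\<And>i. g i \<in> coded_maps M d m D \<theta>"
    and "\<And>a. range a \<subseteq> nlists d (univ M) \<Longrightarrow> coded_map N d \<theta> c (pcls d a) = pcls d (\<lambda>i. g i (a i))"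
proof -
  have D: "formula_in L m D" and \<theta>: "formula_in L (d + d + m) \<theta>"
    using H unfolding coded_symmetry_group_def Let_def by blast+
  obtain e where e: "e \<in> admissible_codes M m D"
    using H unfolding coded_symmetry_group_def Let_def by blast
  have c': "c \<in> nlists m (univ N)" using c unfolding admissible_codes_def extension_def by blast
  obtain cs where cs: "list_all (\<lambda>s. range s \<subseteq> univ M) cs" "c = map cls cs"
    using lists_univ_N[OF nlistsE_set[OF c']] by blast
  have len: "length cs = m" using nlistsE_length[OF c'] cs(2) by simp
  have ev: "eventually (\<lambda>i. map (\<lambda>s. s i) cs \<in> admissible_codes M m D) U"
    using c unfolding admissible_codes_def cs(2) los_extension[OF cs(1) len D] .
  \<comment> \<open>The admissible code e replaces the inadmissible values, so that g takes values
    in H at every index; this happens on a negligible set only.\<close>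
  define code where "code i = (if map (\<lambda>s. s i) cs \<in> admissible_codes M m D then map (\<lambda>s. s i) cs else e)" for i
  have code: "code i \<in> admissible_codes M m D" for i using e by (simp add: code_def)
  define g where "g i = coded_map M d \<theta> (code i)" for i
  have g_closed: "range (\<lambda>i. g i (a i)) \<subseteq> nlists d (univ M)" if a: "range a \<subseteq> nlists d (univ M)" for a
    using bij_betwE[OF coded_map_bij[OF H code]] a unfolding g_def by blast
  have graph: "code_graph N \<theta> c (pcls d a) (pcls d b) \<longleftrightarrow> pcls d b = pcls d (\<lambda>i. g i (a i))"
    if a: "range a \<subseteq> nlists d (univ M)" and b: "range b \<subseteq> nlists d (univ M)" for a b
  proof -
    have ab: "list_all (\<lambda>a. range a \<subseteq> nlists d (univ M)) [a, b]" using a b by simp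
    have all: "list_all (\<lambda>s. range s \<subseteq> univ M) (coords d [a, b] @ cs)"
      using coords_range[OF ab] cs(1) by simp
    have "pcls d a @ pcls d b @ c = map cls (coords d [a, b] @ cs)"
      using concat_pcls[of d "[a, b]"] cs(2) by simp
    then have "code_graph N \<theta> c (pcls d a) (pcls d b) \<longleftrightarrow>
        eventually (\<lambda>i. sat M ((!) (map (\<lambda>s. s i) (coords d [a, b] @ cs))) \<theta>) U"
      unfolding code_graph_def
      by (simp only:) (rule los_nth[OF all], use \<theta> len in \<open>simp add: length_coords mult_2_right\<close>)
    also have "(\<lambda>i. sat M ((!) (map (\<lambda>s. s i) (coords d [a, b] @ cs))) \<theta>) =
        (\<lambda>i. code_graph M \<theta> (map (\<lambda>s. s i) cs) (a i) (b i))"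
      unfolding code_graph_def using coords_at[OF ab] by simp
    also have "eventually \<dots> U \<longleftrightarrow> eventually (\<lambda>i. b i = g i (a i)) U"
    proof (rule eventually_subst, rule eventually_mono[OF ev])
      fix i assume "map (\<lambda>s. s i) cs \<in> admissible_codes M m D"
      moreover have "a i \<in> nlists d (univ M)" "b i \<in> nlists d (univ M)" using a b by blast+
      ultimately show "code_graph M \<theta> (map (\<lambda>s. s i) cs) (a i) (b i) \<longleftrightarrow> b i = g i (a i)"
        using code_graph_iff[OF H] by (simp add: g_def code_def)
    qed
    also have "\<dots> \<longleftrightarrow> pcls d b = pcls d (\<lambda>i. g i (a i))"
      by (rule pcls_eq_iff[symmetric, OF b g_closed[OF a]])
    finally show ?thesis .
  qed
  show thesis
  proof
    show "g i \<in> coded_maps M d m D \<theta>" for i unfolding g_def coded_maps_def using code by blast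
    fix a :: "'i \<Rightarrow> 'a list" assume a: "range a \<subseteq> nlists d (univ M)"
    show "coded_map N d \<theta> c (pcls d a) = pcls d (\<lambda>i. g i (a i))"
      unfolding coded_map_def
    proof (rule the_equality)
      show "pcls d (\<lambda>i. g i (a i)) \<in> nlists d (univ N) \<and> code_graph N \<theta> c (pcls d a) (pcls d (\<lambda>i. g i (a i)))"
        using graph[OF a g_closed[OF a]] pcls_mem[OF g_closed[OF a]] by simp
      fix y assume y: "y \<in> nlists d (univ N) \<and> code_graph N \<theta> c (pcls d a) y"
      then obtain b where "range b \<subseteq> nlists d (univ M)" "y = pcls d b" using pcls_image[of d] by blast
      then show "y = pcls d (\<lambda>i. g i (a i))" using y graph[OF a] by blast
    qed
  qed
qed

text \<open>Number and length of the blocks are fixed, so \<open>concat\<close> is injective on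
  these tuples and R can be recovered from its flattened image.\<close>

lemma power_definable_eq:
  assumes "power_definable L M d n R"
  obtains \<rho> where "formula_in L (d * n) \<rho>" "R = power_extension M d n \<rho>"
proof -
  obtain \<rho> where \<rho>: "formula_in L (d * n) \<rho>" "concat ` R = extension M (d * n) \<rho>"
    and sub: "R \<subseteq> nlists n (nlists d (univ M))"
    using assms unfolding power_definable_def definable_def by blast
  have inj: "inj_on concat (nlists n (nlists d (univ M)))"
  proof (rule inj_onI)
    fix xs ys assume xs: "xs \<in> nlists n (nlists d (univ M))" and ys: "ys \<in> nlists n (nlists d (univ M))"
      and eq: "concat xs = concat ys"
    have "length x = d" if "x \<in> set xs \<union> set ys" for x
      using that nlistsE_set[OF xs] nlistsE_set[OF ys] nlistsE_length[of x d "univ M"] by blast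
    then have "\<forall>(x, y) \<in> set (zip xs ys). length x = length y"
      by (auto dest: set_zip_leftD set_zip_rightD)
    then show "xs = ys"
      using eq concat_eq_concat_iff nlistsE_length[OF xs] nlistsE_length[OF ys] by metis
  qed
  have "R = power_extension M d n \<rho>"
    unfolding power_extension_def \<rho>(2)[symmetric]
    using sub inj by (auto dest: inj_onD)
  then show thesis using that \<rho>(1) by blast
qed

lemma (in ultrapower_of) power_extension_automorphism:
  assumes "automorphism L N \<sigma>" "formula_in L (d * n) \<rho>" "xs \<in> power_extension N d n \<rho>"
  shows "map (map \<sigma>) xs \<in> power_extension N d n \<rho>"
proof -
  have xs: "xs \<in> nlists n (nlists d (univ N))" "concat xs \<in> extension N (d * n) \<rho>"
    using assms(3) unfolding power_extension_def by blast+
  have \<sigma>: "\<sigma> ` univ N = univ N" using assms(1) unfolding automorphism_def bij_betw_def by blast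
  have "map \<sigma> x \<in> nlists d (univ N)" if "x \<in> set xs" for x
  proof -
    have "x \<in> nlists d (univ N)" using nlistsE_set[OF xs(1)] that by blast
    from nlistsE_length[OF this] nlistsE_set[OF this] \<sigma> show ?thesis by (intro nlistsI) auto
  qed
  then have "map (map \<sigma>) xs \<in> nlists n (nlists d (univ N))"
    using nlistsE_length[OF xs(1)] by (intro nlistsI) auto
  moreover have "concat xs \<in> nlists (d * n) (univ N)" using xs(2) unfolding extension_def by blast
  then have "map \<sigma> (concat xs) \<in> extension N (d * n) \<rho>"
    using extension_automorphism[OF is_structure_N assms(1,2)] xs(2) by blast
  ultimately show ?thesis unfolding power_extension_def by (simp add: map_concat)
qed

text \<open>At each index the map acts as some member of H, possibly a different one each time; R is
  preserved by all of them, and Los carries this over.\<close>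

lemma (in ultrapower_of) power_extension_coded_map:
  assumes "coded_symmetry_group L M d k ar Q m D \<theta>" "\<alpha> \<in> coded_maps N d m D \<theta>"
    and \<rho>: "formula_in L (d * n) \<rho>" and R: "preserved_by (coded_maps M d m D \<theta>) (power_extension M d n \<rho>)"
    and xs: "xs \<in> power_extension N d n \<rho>"
  shows "map \<alpha> xs \<in> power_extension N d n \<rho>"
proof -
  obtain c where c: "c \<in> admissible_codes N m D" "\<alpha> = coded_map N d \<theta> c"
    using assms(2) unfolding coded_maps_def by blast
  obtain g where g: "\<And>i. g i \<in> coded_maps M d m D \<theta>"
    "\<And>a. range a \<subseteq> nlists d (univ M) \<Longrightarrow> \<alpha> (pcls d a) = pcls d (\<lambda>i. g i (a i))"
    using coded_map_N[OF assms(1) c(1)] unfolding c(2) by metis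
  have "xs \<in> nlists n (nlists d (univ N))" using xs unfolding power_extension_def by blast
  then obtain as where as: "list_all (\<lambda>a. range a \<subseteq> nlists d (univ M)) as" "length as = n" "xs = map (pcls d) as"
    by (rule nlists_pcls)
  define bs where "bs = map (\<lambda>a i. g i (a i)) as"
  have closed: "g i x \<in> nlists d (univ M)" if "x \<in> nlists d (univ M)" for i x
  proof -
    obtain h where "h \<in> admissible_codes M m D" "g i = coded_map M d \<theta> h"
      using g(1)[of i] unfolding coded_maps_def by blast
    then show ?thesis using bij_betwE[OF coded_map_bij[OF assms(1)]] that by simp
  qed
  have bs: "list_all (\<lambda>a. range a \<subseteq> nlists d (univ M)) bs"
    using as(1) closed unfolding bs_def list_all_iff by auto
  have "map \<alpha> xs = map (pcls d) bs"
    using as(1) unfolding as(3) bs_def list_all_iff by (simp add: g(2))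
  moreover have "eventually (\<lambda>i. map (\<lambda>a. a i) bs \<in> power_extension M d n \<rho>) U"
  proof (rule eventually_mono)
    show "eventually (\<lambda>i. map (\<lambda>a. a i) as \<in> power_extension M d n \<rho>) U"
      using xs unfolding as(3) los_power_extension[OF as(1,2) \<rho>] .
    fix i assume i: "map (\<lambda>a. a i) as \<in> power_extension M d n \<rho>"
    have "map (g i) ` power_extension M d n \<rho> = power_extension M d n \<rho>"
      using R g(1) unfolding preserved_by_def by blast
    then have "map (g i) (map (\<lambda>a. a i) as) \<in> power_extension M d n \<rho>" using i by blast
    then show "map (\<lambda>a. a i) bs \<in> power_extension M d n \<rho>" by (simp add: bs_def comp_def)
  qed
  moreover have "length bs = n" using as(2) by (simp add: bs_def)
  ultimately show ?thesis using los_power_extension[OF bs _ \<rho>] by simp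
qed

section \<open>Moving an undefinable relation\<close>

text \<open>Otherwise R would be closed under level-m equivalence and hence determined by finitely
  many definable sets.\<close>

lemma not_definable_back_forth:
  assumes "finite (dom (rel_arity L))" "R \<subseteq> nlists n (univ P)" "\<not> definable L P n R"
  shows "\<exists>xs ys. xs \<in> R \<and> ys \<in> nlists n (univ P) - R \<and> back_forth L P m xs ys"
proof (rule ccontr)
  assume no: "\<not> ?thesis"
  obtain \<S> where \<S>: "finite \<S>" "\<And>S. S \<in> \<S> \<Longrightarrow> definable L P n S"
    "\<And>xs ys. xs \<in> nlists n (univ P) \<Longrightarrow> ys \<in> nlists n (univ P) \<Longrightarrow>
      (\<forall>S \<in> \<S>. xs \<in> S \<longleftrightarrow> ys \<in> S) \<Longrightarrow> back_forth L P m xs ys"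
    using back_forth_determined[OF assms(1), of P n m] by metis
  have "definable L P n R"
  proof (rule definable_if_determined[OF \<S>(1,2) assms(2)])
    fix xs ys assume "xs \<in> R" "ys \<in> nlists n (univ P)" "\<forall>S \<in> \<S>. xs \<in> S \<longleftrightarrow> ys \<in> S"
    moreover from this have "back_forth L P m xs ys" using assms(2) \<S>(3) by blast
    ultimately show "ys \<in> R" using no by blast
  qed
  then show False using assms(3) by blast
qed

text \<open>At most |V|^|I| \<le> 2^|I| functions have to be listed, and the labels, being the
  subsets of I, are as many. The Boolean lists each function once for either side.\<close>

lemma enumeration_exists:
  fixes A :: "'c set"
  assumes inf: "infinite (UNIV :: 'v set)" and "A \<noteq> {}" and "|A| \<le>o |UNIV :: 'v set|"
  obtains enum :: "'v set set set set \<Rightarrow> ('v set set set \<Rightarrow> 'c) \<times> bool"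
  where "{a. range a \<subseteq> A} \<times> UNIV \<subseteq> range enum"
proof -
  note inf3 = infinite_sets[OF infinite_sets[OF infinite_sets[OF inf]]]
  note inf4 = infinite_sets[OF inf3]
  have v3: "|UNIV :: 'v set| \<le>o |UNIV :: 'v set set set set|"
    using ordLeq_transitive[OF card_of_singletons ordLeq_transitive[OF card_of_singletons card_of_singletons]] .
  have v4: "|UNIV :: 'v set| \<le>o |UNIV :: 'v set set set set set|"
    using ordLeq_transitive[OF v3 card_of_singletons] .
  have "|UNIV :: 'v set set set set| \<le>o |UNIV :: 'v set set set set|" by (rule card_of_mono1) simp
  then have "|UNIV :: ('v set set set \<Rightarrow> 'v) set| \<le>o |UNIV :: 'v set set set set set|"
    by (rule card_of_fun_le[OF inf3 _ v4])
  moreover have "|UNIV :: bool set| \<le>o |UNIV :: 'v set set set set set|"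
    by (rule ordLess_imp_ordLeq) (rule finite_ordLess_infinite[OF card_of_Well_order card_of_Well_order]; simp add: inf4 Field_card_of)
  ultimately have "|UNIV :: (('v set set set \<Rightarrow> 'v) \<times> bool) set| \<le>o |UNIV :: 'v set set set set set|"
    by (rule card_of_prod_le[OF inf4])
  then obtain e :: "'v set set set set \<Rightarrow> ('v set set set \<Rightarrow> 'v) \<times> bool" where e: "surj e"
    using card_of_ordLeq2[OF UNIV_not_empty] by metis
  obtain dA :: "'v \<Rightarrow> 'c" where dA: "range dA = A"
    using assms(3) card_of_ordLeq2[OF assms(2)] by metis
  show thesis
  proof (rule that, rule subsetI)
    fix p :: "('v set set set \<Rightarrow> 'c) \<times> bool" assume p: "p \<in> {a. range a \<subseteq> A} \<times> UNIV"
    have "dA (inv dA (fst p i)) = fst p i" for i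
      using p dA by (intro f_inv_into_f) auto
    moreover obtain x where "e x = (\<lambda>i. inv dA (fst p i), snd p)" using e by (metis surj_def)
    ultimately have "p = (\<lambda>i. dA (fst (e x) i), snd (e x))" by simp
    then show "p \<in> range (\<lambda>x. (\<lambda>i. dA (fst (e x) i), snd (e x)))" by (rule range_eqI)
  qed
qed

text \<open>The starting tuples vary with the index: at i they are equivalent to level
  \<open>t i\<close>. Since \<open>t i = m\<close> can be prescribed along with |V| values of the
  family, the starting agreement sets of all levels are consistent, though no fixed pair of tuples
  in P has to be equivalent to every level.\<close>

lemma undefinable_coupling:
  fixes P :: "('f, 'r, 'c) struct"
  defines "X \<equiv> {a :: 'v set set set \<Rightarrow> 'c. range a \<subseteq> univ P}"
  assumes inf: "infinite (UNIV :: 'v set)" and P: "univ P \<noteq> {}" "|univ P| \<le>o |UNIV :: 'v set|"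
    and fin: "finite (dom (rel_arity L))" and R: "R \<subseteq> nlists n (univ P)" "\<not> definable L P n R"
  obtains U :: "'v set set set filter" and S and ps where
    "ultrafilter U" "S \<subseteq> X \<times> X" "fst ` S = X" "snd ` S = X"
    "\<And>m qs. qs \<in> lists S \<Longrightarrow> eventually (\<lambda>i. i \<in> agree L P m qs) U"
    "ps \<in> lists S" "\<And>i. map (\<lambda>p. fst p i) ps \<in> R" "\<And>i. map (\<lambda>p. snd p i) ps \<in> nlists n (univ P) - R"
proof -
  obtain f :: "'v set set set set \<Rightarrow> 'v set set set \<Rightarrow> 'c" and t :: "'v set set set \<Rightarrow> nat"
    where f: "\<And>Y i. f Y i \<in> univ P"
      and ft: "\<And>T s m. |T| \<le>o |UNIV :: 'v set| \<Longrightarrow> s ` T \<subseteq> univ P \<Longrightarrow> \<exists>i. t i = m \<and> (\<forall>Y \<in> T. f Y i = s Y)"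
    using independent_family[OF inf P] by metis
  obtain enum :: "'v set set set set \<Rightarrow> ('v set set set \<Rightarrow> 'c) \<times> bool" where enum: "X \<times> UNIV \<subseteq> range enum"
    using enumeration_exists[OF inf P] unfolding X_def by metis
  obtain xs ys where xs: "\<And>m. xs m \<in> R" and ys: "\<And>m. ys m \<in> nlists n (univ P) - R"
    and bf: "\<And>m. back_forth L P m (xs m) (ys m)"
    using not_definable_back_forth[OF fin R] by metis
  have xs': "xs m \<in> nlists n (univ P)" for m using xs R(1) by blast
  have ys': "ys m \<in> nlists n (univ P)" for m using ys by blast
  define ps :: "(('v set set set \<Rightarrow> 'c) \<times> ('v set set set \<Rightarrow> 'c)) list"
    where "ps = map (\<lambda>j. (\<lambda>i. xs (t i) ! j, \<lambda>i. ys (t i) ! j)) [0..<n]"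
  have at: "map (\<lambda>p. fst p i) ps = xs (t i)" "map (\<lambda>p. snd p i) ps = ys (t i)" for i
    using map_nth[of "xs (t i)"] map_nth[of "ys (t i)"] nlistsE_length[OF xs'[of "t i"]] nlistsE_length[OF ys'[of "t i"]]
    unfolding ps_def by (simp_all add: comp_def)
  have cons: "consistent (UNIV :: 'v set) (univ P) f (agreements L P (set ps)) UNIV"
    unfolding consistent_def
  proof (intro ballI allI impI)
    fix e T and s :: "'v set set set set \<Rightarrow> 'c"
    assume e: "e \<in> agreements L P (set ps)" and T: "|T| \<le>o |UNIV :: 'v set|" "s ` T \<subseteq> univ P"
    obtain qs m where qs: "qs \<in> lists (set ps)" "e = agree L P m qs" using e unfolding agreements_def by blast
    obtain i where i: "t i = m" "\<forall>Y \<in> T. f Y i = s Y" using ft[OF T] by blast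
    have "i \<in> agree L P m ps" using bf[of m] unfolding agree_def by (simp only: mem_Collect_eq at i(1))
    moreover have "agree L P m ps \<subseteq> agree L P m qs" using qs(1) by (intro agree_antimono) auto
    ultimately show "\<exists>i \<in> e. \<forall>Y \<in> T. f Y i = s Y" using qs(2) i(2) by blast
  qed
  have c1: "|UNIV :: 'v set| \<le>o |UNIV :: 'v set set set set|"
    using ordLeq_transitive[OF card_of_singletons ordLeq_transitive[OF card_of_singletons card_of_singletons]] .
  have c2: "|UNIV :: 'v set set set set| <o |UNIV :: 'v set set set set set|"
    using card_of_Pow[of "UNIV :: 'v set set set set"] by simp
  have infI: "infinite (UNIV :: 'v set set set set)"
    using infinite_sets[OF infinite_sets[OF infinite_sets[OF inf]]] .
  have c3: "|set ps| \<le>o |UNIV :: 'v set set set set|"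
    by (rule ordLess_imp_ordLeq) (rule finite_ordLess_infinite[OF card_of_Well_order card_of_Well_order]; simp add: infI Field_card_of)
  have c4: "set ps \<subseteq> X \<times> X"
    unfolding X_def ps_def using nlistsE_nth_in[OF xs'] nlistsE_nth_in[OF ys'] by auto
  obtain S where S: "set ps \<subseteq> S" "S \<subseteq> X \<times> X" "fst ` S = X" "snd ` S = X" "{} \<notin> agreements L P S"
    by (rule coupling_exists[OF inf P(2) c1 c2 f enum[unfolded X_def] c3 c4[unfolded X_def] cons, folded X_def])
  define F where "F = (INF e \<in> agreements L P S. principal e)"
  have "F \<noteq> bot"
  proof -
    have "\<exists>e'' \<in> agreements L P S. principal e'' \<le> inf (principal e) (principal e')"
      if e: "e \<in> agreements L P S" "e' \<in> agreements L P S" for e e'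
    proof -
      obtain qs m qs' m' where qs: "qs \<in> lists S" "e = agree L P m qs" "qs' \<in> lists S" "e' = agree L P m' qs'"
        using e unfolding agreements_def by blast
      let ?e = "agree L P (max m m') (qs @ qs')"
      have "?e \<subseteq> e" "?e \<subseteq> e'" unfolding qs by (intro agree_antimono; simp)+
      moreover have "qs @ qs' \<in> lists S" using qs by simp
      then have "?e \<in> agreements L P S" unfolding agreements_def by blast
      ultimately show ?thesis by (intro bexI[of _ ?e]) auto
    qed
    then have "F = bot \<longleftrightarrow> (\<exists>e \<in> agreements L P S. principal e = bot)"
      unfolding F_def by (rule INF_filter_bot_base)
    then show ?thesis using S(5) by (auto simp: principal_eq_bot_iff)
  qed
  then obtain U where U: "U \<le> F" "ultrafilter U" by (rule ultrafilter_exists)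
  have ev: "eventually (\<lambda>i. i \<in> agree L P m qs) U" if "qs \<in> lists S" for m qs
  proof -
    have "agree L P m qs \<in> agreements L P S" using that unfolding agreements_def by blast
    then have "U \<le> principal (agree L P m qs)" using U(1) unfolding F_def by (meson INF_lower order_trans)
    then show ?thesis by (simp add: le_principal)
  qed
  show thesis
    by (rule that[OF U(2) S(2-4) ev, of ps]) (use S(1) xs ys in \<open>auto simp: at\<close>)
qed

text \<open>Agreement at level 0 is what is read off: on equalities it makes \<alpha> well defined
  and injective, on the relations it makes \<alpha> a homomorphism in both directions. The two
  projections of S give domain and range.\<close>

lemma (in ultrapower_of) coupling_automorphism:
  fixes d :: nat
  defines "X \<equiv> {a. range a \<subseteq> nlists d (univ M)}"
  assumes q: "\<And>j. j < k \<Longrightarrow> formula_in L (d * ar j) (q j)"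
    and Q: "\<And>j. j < k \<Longrightarrow> Q j = power_extension M d (ar j) (q j)"
    and S: "S \<subseteq> X \<times> X" "fst ` S = X" "snd ` S = X"
    and ev: "\<And>ps. ps \<in> lists S \<Longrightarrow> eventually (\<lambda>i. i \<in> agree (rel_lang k ar) (power_struct M d Q) 0 ps) U"
  obtains \<alpha> where
    "automorphism (rel_lang k ar) (power_struct N d (\<lambda>j. power_extension N d (ar j) (q j))) \<alpha>"
    "\<And>p. p \<in> S \<Longrightarrow> \<alpha> (pcls d (fst p)) = pcls d (snd p)"
proof -
  have pX: "range (fst p) \<subseteq> nlists d (univ M)" "range (snd p) \<subseteq> nlists d (univ M)" if "p \<in> S" for p
  proof -
    have "p \<in> X \<times> X" using S(1) that by blast
    then show "range (fst p) \<subseteq> nlists d (univ M)" "range (snd p) \<subseteq> nlists d (univ M)"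
      unfolding X_def mem_Times_iff by simp_all
  qed
  have eq: "pcls d (fst p) = pcls d (fst p') \<longleftrightarrow> pcls d (snd p) = pcls d (snd p')" if p: "p \<in> S" "p' \<in> S" for p p'
  proof -
    have "eventually (\<lambda>i. i \<in> agree (rel_lang k ar) (power_struct M d Q) 0 [p, p']) U" using ev p by simp
    then have "eventually (\<lambda>i. (fst p i = fst p' i) = (snd p i = snd p' i)) U"
    proof (rule eventually_mono)
      fix i assume "i \<in> agree (rel_lang k ar) (power_struct M d Q) 0 [p, p']"
      then have "\<forall>a < 2. \<forall>b < 2. [fst p i, fst p' i] ! a = [fst p i, fst p' i] ! b \<longleftrightarrow>
          [snd p i, snd p' i] ! a = [snd p i, snd p' i] ! b"
        unfolding agree_def by (simp add: numeral_2_eq_2)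
      from this[rule_format, of 0 1] show "(fst p i = fst p' i) = (snd p i = snd p' i)" by simp
    qed
    then have "eventually (\<lambda>i. fst p i = fst p' i) U \<longleftrightarrow> eventually (\<lambda>i. snd p i = snd p' i) U"
      by (rule eventually_subst)
    then show ?thesis using pX p by (simp add: pcls_eq_iff)
  qed
  \<comment> \<open>A class may be the left class of several pairs; by \<open>eq\<close> they all
    have the same right class, so the choice is harmless.\<close>
  define \<alpha> where "\<alpha> x = pcls d (snd (SOME p. p \<in> S \<and> pcls d (fst p) = x))" for x
  have \<alpha>: "\<alpha> (pcls d (fst p)) = pcls d (snd p)" if p: "p \<in> S" for p
  proof -
    have "\<exists>p'. p' \<in> S \<and> pcls d (fst p') = pcls d (fst p)" using p by blast
    from someI_ex[OF this] show ?thesis unfolding \<alpha>_def using eq p by blast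
  qed
  have univ1: "nlists d (univ N) = (\<lambda>p. pcls d (fst p)) ` S"
    using pcls_image[of d] S(2) unfolding X_def by (metis image_image)
  have univ2: "nlists d (univ N) = (\<lambda>p. pcls d (snd p)) ` S"
    using pcls_image[of d] S(3) unfolding X_def by (metis image_image)
  have "bij_betw \<alpha> (nlists d (univ N)) (nlists d (univ N))"
    unfolding bij_betw_def
  proof
    show "inj_on \<alpha> (nlists d (univ N))" 
    proof (rule inj_onI)
      fix x y assume "x \<in> nlists d (univ N)" "y \<in> nlists d (univ N)" and xy: "\<alpha> x = \<alpha> y"
      then obtain p p' where "p \<in> S" "x = pcls d (fst p)" "p' \<in> S" "y = pcls d (fst p')"
        unfolding univ1 by blast
      then show "x = y" using xy \<alpha> eq by simp
    qed
    show "\<alpha> ` nlists d (univ N) = nlists d (univ N)"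
      by (subst univ1, subst univ2) (simp add: image_image \<alpha>)
  qed
  moreover have "xs \<in> power_extension N d (ar j) (q j) \<longleftrightarrow> map \<alpha> xs \<in> power_extension N d (ar j) (q j)"
    if j: "j < k" and xs: "xs \<in> nlists (ar j) (nlists d (univ N))" for j xs
  proof -
    have "xs \<in> lists ((\<lambda>p. pcls d (fst p)) ` S)" using nlistsE_set[OF xs] unfolding univ1 by auto
    then obtain ps where ps: "ps \<in> lists S" "xs = map (\<lambda>p. pcls d (fst p)) ps"
      unfolding lists_image by blast
    have len: "length ps = ar j" using nlistsE_length[OF xs] ps(2) by simp
    have psX: "list_all (\<lambda>a. range a \<subseteq> nlists d (univ M)) (map fst ps)"
      "list_all (\<lambda>a. range a \<subseteq> nlists d (univ M)) (map snd ps)"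
      using ps(1) pX by (simp_all add: list_all_iff in_lists_conv_set)
    have "xs \<in> power_extension N d (ar j) (q j) \<longleftrightarrow> eventually (\<lambda>i. map (\<lambda>p. fst p i) ps \<in> Q j) U"
      using los_power_extension[OF psX(1) _ q[OF j]] len unfolding ps(2) Q[OF j] by (simp add: comp_def)
    also have "\<dots> \<longleftrightarrow> eventually (\<lambda>i. map (\<lambda>p. snd p i) ps \<in> Q j) U"
    proof (rule eventually_subst, rule eventually_mono[OF ev[OF ps(1)]])
      fix i assume i: "i \<in> agree (rel_lang k ar) (power_struct M d Q) 0 ps"
      have "[0..<ar j] \<in> nlists (ar j) {..<length ps}" using len by (intro nlistsI) auto
      moreover have "rel_arity (rel_lang k ar) j = Some (ar j)" using j by (simp add: rel_lang_def)
      ultimately have "map ((!) (map (\<lambda>p. fst p i) ps)) [0..<ar j] \<in> Q j \<longleftrightarrow>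
          map ((!) (map (\<lambda>p. snd p i) ps)) [0..<ar j] \<in> Q j"
        using i unfolding agree_def by (simp add: power_struct_def del: map_map)
      then show "map (\<lambda>p. fst p i) ps \<in> Q j \<longleftrightarrow> map (\<lambda>p. snd p i) ps \<in> Q j"
        using map_nth[of "map (\<lambda>p. fst p i) ps"] map_nth[of "map (\<lambda>p. snd p i) ps"] len by simp
    qed
    also have "\<dots> \<longleftrightarrow> map (pcls d) (map snd ps) \<in> power_extension N d (ar j) (q j)"
      using los_power_extension[OF psX(2) _ q[OF j]] len unfolding Q[OF j] by (simp add: comp_def)
    also have "map (pcls d) (map snd ps) = map \<alpha> xs" using ps \<alpha> by auto
    finally show ?thesis .
  qed
  ultimately have "automorphism (rel_lang k ar) (power_struct N d (\<lambda>j. power_extension N d (ar j) (q j))) \<alpha>"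
    unfolding automorphism_def rel_lang_def power_struct_def by (simp split: if_splits)
  then show thesis using \<alpha> that by blast
qed

theorem proposition8p5:
  fixes L :: "('f, 'r) lang" and M :: "('f, 'r, 'a) struct"
    and d k m n :: nat and ar :: "nat \<Rightarrow> nat"
    and Q :: "nat \<Rightarrow> 'a list list set" and q :: "nat \<Rightarrow> ('f, 'r) fm"
    and D \<theta> :: "('f, 'r) fm" and R :: "'a list list set"
  assumes "is_structure L M" and "d \<ge> 1"
    and "\<And>i. i < k \<Longrightarrow> formula_in L (d * ar i) (q i)"
    and "\<And>i. i < k \<Longrightarrow> Q i = power_extension M d (ar i) (q i)"
    and "coded_symmetry_group L M d k ar Q m D \<theta>"
    and "factorisation_faithful TYPE('a ultra_index) L M d k ar q m D \<theta>"
    and "n \<ge> 1" and "power_definable L M d n R"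
  shows "R \<in> Conc (rel_lang k ar) (power_struct M d Q) \<longleftrightarrow>
    preserved_by (coded_maps M d m D \<theta>) R"
proof
  let ?L = "rel_lang k ar" and ?P = "power_struct M d Q"
  have "univ M \<noteq> {}" using assms(1) unfolding is_structure_def by blast
  moreover have "Q i \<subseteq> nlists (ar i) (nlists d (univ M))" if "i < k" for i
    using assms(4)[OF that] unfolding power_extension_def by blast
  ultimately have P: "is_structure ?L ?P" by (rule is_structure_power_struct)
  {
    assume "R \<in> Conc ?L ?P"
    then obtain n' where R: "definable ?L ?P n' R" unfolding Conc_def by blast
    show "preserved_by (coded_maps M d m D \<theta>) R"
      unfolding preserved_by_def coded_maps_def
      using automorphism_image_definable[OF P coded_map_automorphism[OF assms(5)] R] by blast
  }
  assume H: "preserved_by (coded_maps M d m D \<theta>) R"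
  obtain \<rho> where \<rho>: "formula_in L (d * n) \<rho>" "R = power_extension M d n \<rho>"
    by (rule power_definable_eq[OF assms(8)])
  have univ_P: "univ ?P = nlists d (univ M)" by (simp add: power_struct_def)
  have "definable ?L ?P n R"
  proof (rule ccontr)
    assume nd: "\<not> definable ?L ?P n R"
    \<comment> \<open>V is \<open>'a + nat\<close>, infinite whatever \<open>'a\<close> is, and the
      ultrafilter lives on its triple power set. The universe M^d consists of lists over
      \<open>'a\<close> and is therefore no larger than V.\<close>
    have inf: "infinite (UNIV :: ('a + nat) set)" by (simp add: UNIV_Plus_UNIV[symmetric] del: UNIV_Plus_UNIV)
    have P1: "univ ?P \<noteq> {}" using P unfolding is_structure_def by blast
    have "|UNIV :: 'a set| \<le>o |UNIV :: ('a + nat) set|"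
      by (rule card_of_ordLeqI[of Inl]) auto
    then have "|lists (UNIV :: 'a set)| \<le>o |UNIV :: ('a + nat) set|" by (rule card_of_lists_le[OF inf])
    then have P2: "|univ ?P| \<le>o |UNIV :: ('a + nat) set|"
      by (rule ordLeq_transitive[OF card_of_mono1, rotated]) simp
    have "dom (rel_arity ?L) \<subseteq> {..<k}" by (auto simp: rel_lang_def split: if_splits)
    then have fin: "finite (dom (rel_arity ?L))" by (rule finite_subset) simp
    have R: "R \<subseteq> nlists n (univ ?P)" unfolding \<rho>(2) univ_P power_extension_def by blast
    obtain U :: "'a ultra_index filter" and S and ps where U: "ultrafilter U"
      and S: "S \<subseteq> {a. range a \<subseteq> univ ?P} \<times> {a. range a \<subseteq> univ ?P}"
        "fst ` S = {a. range a \<subseteq> univ ?P}" "snd ` S = {a. range a \<subseteq> univ ?P}"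
      and ev: "\<And>m qs. qs \<in> lists S \<Longrightarrow> eventually (\<lambda>i. i \<in> agree ?L ?P m qs) U"
      and ps: "ps \<in> lists S" "\<And>i. map (\<lambda>p. fst p i) ps \<in> R"
        "\<And>i. map (\<lambda>p. snd p i) ps \<in> nlists n (univ ?P) - R"
      by (rule undefinable_coupling[OF inf P1 P2 fin R nd]) (rule that)
    interpret ultrapower_of L M U by unfold_locales (fact assms(1) U)+
    obtain \<alpha> where \<alpha>: "automorphism ?L (power_struct N d (\<lambda>j. power_extension N d (ar j) (q j))) \<alpha>"
      "\<And>p. p \<in> S \<Longrightarrow> \<alpha> (pcls d (fst p)) = pcls d (snd p)"
      by (rule coupling_automorphism[OF assms(3,4) S[unfolded univ_P] ev]) (assumption | rule that)+
    obtain h \<sigma> where h: "h \<in> coded_maps N d m D \<theta>" and \<sigma>: "automorphism L N \<sigma>"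
      and fact: "\<And>x. x \<in> nlists d (univ N) \<Longrightarrow> \<alpha> x = h (map \<sigma> x)"
      using assms(6) U \<alpha>(1) unfolding factorisation_faithful_def Let_def by blast
    have len: "length ps = n" using nlistsE_length[of "map (\<lambda>p. fst p undefined) ps" n "univ ?P"] ps(2) R by auto
    have "fst p \<in> fst ` S" "snd p \<in> snd ` S" if "p \<in> set ps" for p using ps(1) that by auto
    then have psX: "list_all (\<lambda>a. range a \<subseteq> nlists d (univ M)) (map fst ps)"
      "list_all (\<lambda>a. range a \<subseteq> nlists d (univ M)) (map snd ps)"
      unfolding S(2,3) univ_P by (simp_all add: list_all_iff)
    let ?xs = "map (pcls d) (map fst ps)" and ?ys = "map (pcls d) (map snd ps)"
    have "map (\<lambda>a. a i) (map fst ps) \<in> R" for i using ps(2)[of i] by (simp add: comp_def)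
    then have xs: "?xs \<in> power_extension N d n \<rho>"
      using los_power_extension[OF psX(1) _ \<rho>(1)] len \<rho>(2) by simp
    \<comment> \<open>Both factors of \<alpha> keep the tuple inside the relation defined by \<rho>
      in the ultrapower. Yet \<alpha> takes it to \<open>?ys\<close>, whose representatives lie
      outside R at every index.\<close>
    have "map h (map (map \<sigma>) ?xs) \<in> power_extension N d n \<rho>"
      by (rule power_extension_coded_map[OF assms(5) h \<rho>(1) H[unfolded \<rho>(2)]
            power_extension_automorphism[OF \<sigma> \<rho>(1) xs]])
    moreover have "map h (map (map \<sigma>) ?xs) = ?ys"
    proof -
      have "h (map \<sigma> (pcls d (fst p))) = pcls d (snd p)" if "p \<in> set ps" for p
      proof -
        have "p \<in> S" using ps(1) that by auto
        moreover have "pcls d (fst p) \<in> nlists d (univ N)"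
          using psX(1) that by (intro pcls_mem) (auto simp: list_all_iff)
        ultimately show ?thesis using fact \<alpha>(2) by metis
      qed
      then show ?thesis by simp
    qed
    ultimately have "?ys \<in> power_extension N d n \<rho>" by (simp only:)
    then have "eventually (\<lambda>i. map (\<lambda>a. a i) (map snd ps) \<in> R) U"
      using los_power_extension[OF psX(2) _ \<rho>(1)] len \<rho>(2) by simp
    moreover have "map (\<lambda>a. a i) (map snd ps) \<notin> R" for i using ps(3)[of i] by (simp add: comp_def)
    ultimately have "U = bot" by (simp add: eventually_False)
    then show False using U unfolding ultrafilter_def by blast
  qed
  then show "R \<in> Conc ?L ?P" using assms(7) unfolding Conc_def by blast
qed

end
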